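(* Let $\boldsymbol\lambda\in\mathbb Z_{\ge0}^N$, $|\boldsymbol\lambda|=n$, let $\tilde q_1,\dots,\tilde q_N$ be distinct nonzero complex numbers, and put $(q_1,\dots,q_N)=(\tilde q_1^{\,-1},\dots,\tilde q_N^{\,-1})$. Then for $i=1,\dots,N$ the operator $D_i*_{\tilde{\boldsymbol q}}$ of quantum multiplication by $D_i=\gamma_{i,1}+\dots+\gamma_{i,\lambda_i}$ on $H^*_T(T^*\mathcal F_{\boldsymbol\lambda})$ equals the action $\rho(X^q_{\boldsymbol\lambda,i})$ on $H^*_T(T^*\mathcal F_{\boldsymbol\lambda})$ of the dynamical Hamiltonian $X^q_{\boldsymbol\lambda,i}$.
   Context: Setting. Fix positive integers $N,n$. For $\boldsymbol\lambda=(\lambda_1,\dots,\lambda_N)\in\mathbb Z_{\ge0}^N$ with $|\boldsymbol\lambda|=\sum_i\lambda_i=n$, $\mathcal F_{\boldsymbol\lambda}$ is the variety of flags $0=F_0\subset F_1\subset\dots\subset F_N=\mathbb C^n$ with $\dim F_i/F_{i-1}=\lambda_i$; $\mathcal X_n=\bigsqcup_{|\boldsymbol\lambda|=n}T^*\mathcal F_{\boldsymbol\lambda}$. $A\subset GL_n(\mathbb C)$ is the diagonal torus, $T=A\times\mathbb C^\times$, where $\mathbb C^\times$ acts on $T^*\mathcal F_{\boldsymbol\lambda}$ by scaling the fibers, with weight denoted $-h$; $H^*_T(pt)=\mathbb C[\boldsymbol z;h]$, $\boldsymbol z=(z_1,\dots,z_n)$. $H^*_T(T^*\mathcal F_{\boldsymbol\lambda})=\mathbb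 C[\boldsymbol\Gamma]^{S_{\lambda_1}\times\dots\times S_{\lambda_N}}\otimes\mathbb C[\boldsymbol z;h]\big/\big\langle\prod_{i=1}^N\prod_{j=1}^{\lambda_i}(u-\gamma_{i,j})=\prod_{a=1}^n(u-z_a)\big\rangle$, where $\Gamma_i=\{\gamma_{i,1},\dots,\gamma_{i,\lambda_i}\}$ are the Chern roots of the bundle with fiber $F_i/F_{i-1}$, $\boldsymbol\Gamma=(\Gamma_1;\dots;\Gamma_N)$; $[f]$ is the class of a polynomial $f(\boldsymbol\Gamma;\boldsymbol z;h)$ symmetric in each $\Gamma_i$; $1_{\boldsymbol\lambda}\in H^*_T(T^*\mathcal F_{\boldsymbol\lambda})$ is the identity. Yangian. $Y(\mathfrak{gl}_N)$ is the unital associative $\mathbb C$-algebra with generators $T_{i,j}^{\{s\}}$, $i,j=1,\dots,N$, $s\in\mathbb Z_{>0}$, and relations $(u-v)[T_{i,j}(u),T_{k,l}(v)]=T_{k,j}(v)T_{i,l}(u)-T_{k,j}(u)T_{i,l}(v)$, where $T_{i,j}(u)=\delta_{i,j}+\sum_{s\ge1}T_{i,j}^{\{s\}}u^{-s}$. $U(\mathfrak{gl}_N)$ is embedded by $e_{i,j}\mapsto T_{j,i}^{\{1\}}$. $\widetilde Y(\mathfrak{gl}_N)$ is the subalgebra of $Y(\mathfrak{gl}_N)\otimes\mathbb C[h]$ generated over $\mathbb C$ by $\mathbb C[h]$ and the elements $(-h)^{s-1}T_{i,j}^{\{s\}}$. For $\boldsymbol i=\{i_1<\dots<i_p\}$,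 $\boldsymbol j=\{j_1<\dots<j_p\}$ put $M_{\boldsymbol i,\boldsymbol j}(u)=\sum_{\sigma\in S_p}(-1)^\sigma T_{i_1,j_{\sigma(1)}}(u)\cdots T_{i_p,j_{\sigma(p)}}(u-p+1)$, and with $\boldsymbol i=\{1,\dots,p\}$, $\boldsymbol j=\{1,\dots,p-1,p+1\}$ set $$A_p(u)=M_{\boldsymbol i,\boldsymbol i}(-u/h)\ (1\le p\le N),\quad E_p(u)=-h^{-1}M_{\boldsymbol j,\boldsymbol i}(-u/h)\,M_{\boldsymbol i,\boldsymbol i}(-u/h)^{-1},\quad F_p(u)=-h^{-1}M_{\boldsymbol i,\boldsymbol i}(-u/h)^{-1}M_{\boldsymbol i,\boldsymbol j}(-u/h)\ (1\le p\le N-1),$$ viewed as series in $u^{-1}$. The coefficients of $E_p(u)$, $F_p(u)$, $h^{-1}(A_p(u)-1)$ together with $\mathbb C[h]$ generate $\widetilde Y(\mathfrak{gl}_N)$. Module structure $\rho$ on $H^*_T(\mathcal X_n)=\bigoplus_{|\boldsymbol\lambda|=n}H^*_T(T^*\mathcal F_{\boldsymbol\lambda})$. $\mathbb C[h]$ acts by multiplication. Let $\alpha_p=(0,\dots,0,1,-1,0,\dots,0)$ with $p-1$ first zeros (summands indexed by vectors with a negative entry are zero). Then (this is known to define a $\widetilde Y(\mathfrak{gl}_N)$-action) $$\rho(A_p(u)):H^*_T(T^*\mathcal F_{\boldsymbol\lambda})\to H^*_T(T^*\mathcal F_{\boldsymbol\lambda}),\quad [f]\mapsto\Big[f(\boldsymbol\Gamma;\boldsymbol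 z;h)\prod_{a=1}^p\prod_{i=1}^{\lambda_a}\Big(1-\frac h{u-\gamma_{a,i}}\Big)\Big],$$ $$\rho(E_p(u)):H^*_T(T^*\mathcal F_{\boldsymbol\lambda-\alpha_p})\to H^*_T(T^*\mathcal F_{\boldsymbol\lambda}),\quad [f]\mapsto\Big[\sum_{i=1}^{\lambda_p}\frac{f(\boldsymbol\Gamma^{\prime i};\boldsymbol z;h)}{u-\gamma_{p,i}}\prod_{j\ne i}\frac1{\gamma_{p,j}-\gamma_{p,i}}\prod_{k=1}^{\lambda_{p+1}}(\gamma_{p,i}-\gamma_{p+1,k}-h)\Big],$$ $$\rho(F_p(u)):H^*_T(T^*\mathcal F_{\boldsymbol\lambda+\alpha_p})\to H^*_T(T^*\mathcal F_{\boldsymbol\lambda}),\quad [f]\mapsto\Big[\sum_{i=1}^{\lambda_{p+1}}\frac{f(\boldsymbol\Gamma^{i\prime};\boldsymbol z;h)}{u-\gamma_{p+1,i}}\prod_{j\ne i}\frac1{\gamma_{p+1,i}-\gamma_{p+1,j}}\prod_{k=1}^{\lambda_p}(\gamma_{p,k}-\gamma_{p+1,i}-h)\Big],$$ where $\boldsymbol\Gamma^{\prime i}$ is obtained from $\boldsymbol\Gamma$ by moving $\gamma_{p,i}$ from $\Gamma_p$ to $\Gamma_{p+1}$, and $\boldsymbol\Gamma^{i\prime}$ by moving $\gamma_{p+1,i}$ from $\Gamma_{p+1}$ to $\Gamma_p$. Dynamical Hamiltonians. For $i\ne j$ put $G_{i,j}=e_{i,j}e_{j,i}-e_{i,i}=e_{j,i}e_{i,j}-e_{j,j}$,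 and $$X^\infty_i=-hT_{i,i}^{\{2\}}+\tfrac h2\,e_{i,i}(e_{i,i}-1)+h(G_{i,1}+\dots+G_{i,i-1}).$$ Given $\boldsymbol\lambda$, put $G_{\boldsymbol\lambda,i,j}=e_{j,i}e_{i,j}$ if $\lambda_i\ge\lambda_j$ and $G_{\boldsymbol\lambda,i,j}=e_{i,j}e_{j,i}$ if $\lambda_i<\lambda_j$. For distinct numbers $q_1,\dots,q_N$, $$X^q_{\boldsymbol\lambda,i}=X^\infty_i-h\sum_{j=1}^{i-1}\frac{q_i}{q_i-q_j}G_{\boldsymbol\lambda,i,j}-h\sum_{j=i+1}^N\frac{q_j}{q_i-q_j}G_{\boldsymbol\lambda,i,j}\in\widetilde Y(\mathfrak{gl}_N).$$ Quantum multiplication. $D_i*_{\tilde{\boldsymbol q}}$ is the operator of ($T$-equivariant) quantum multiplication by $D_i$ on $H^*_T(T^*\mathcal F_{\boldsymbol\lambda})$ with parameters $\tilde{\boldsymbol q}=(\tilde q_1,\dots,\tilde q_N)$, in the conventions of Maulik–Okounkov, in which (their theorem, used here as the description of the operator) $$D_i*_{\tilde{\boldsymbol q}}=(\gamma_{i,1}+\dots+\gamma_{i,\lambda_i})+h\sum_{j=1}^{i-1}\frac{\tilde q_j/\tilde q_i}{1-\tilde q_j/\tilde q_i}\,\rho(e_{j,i}e_{i,j})-h\sum_{j=i+1}^N\frac{\tilde q_i/\tilde q_j}{1-\tilde q_i/\tilde q_j}\,\rho(e_{i,j}e_{j,i})+C,$$ where the first term is the operator of ordinary multiplication by $D_i$,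 and $C$ is a scalar operator on $H^*_T(T^*\mathcal F_{\boldsymbol\lambda})$ fixed by the requirement that the purely quantum part $D_i*_{\tilde{\boldsymbol q}}-D_i$ annihilates $1_{\boldsymbol\lambda}$. *)

theory Defs
  imports
    Complex_Main
    "HOL-Library.Poly_Mapping"
    "HOL-Library.Countable"
    "HOL-Library.FuncSet"
    "HOL-Combinatorics.Permutations"
    "HOL-Computational_Algebra.Polynomial"
    "HOL-Computational_Algebra.Formal_Power_Series"
    "HOL-Computational_Algebra.Fraction_Field"
    "HOL-Algebra.QuotRing"
    "HOL-Algebra.Generated_Rings"
begin

unbundle fps_syntax

section \<open>Conventions\<close>

text \<open>
  A series in \<open>u\<inverse>\<close> is an \<^typ>\<open>'a fps\<close> whose formal variable is \<open>u\<inverse>\<close>.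
  The following is the expansion of \<open>1 / (u - c)\<close> in \<open>u\<inverse>\<close>.
\<close>

definition inv_u_minus :: "'a::ring_1 \<Rightarrow> 'a fps" where
  "inv_u_minus c = Abs_fps (\<lambda>s. if s = 0 then 0 else c ^ (s - 1))"

text \<open>
  A subring of a type-class ring, viewed as a ring with explicit carrier.
\<close>

definition ring_on :: "'a::ring_1 set \<Rightarrow> 'a ring" where
  "ring_on S = \<lparr>carrier = S, mult = (*), one = 1, zero = 0, add = (+)\<rparr>"


section \<open>The Yangian\<close>

text \<open>
  Words under concatenation (written additively, as required for the exponents of
  \<^typ>\<open>'a \<Rightarrow>\<^sub>0 'b\<close>): \<open>'a fword \<Rightarrow>\<^sub>0 R\<close> is the free associative \<open>R\<close>-algebra on \<open>'a\<close>.
\<close>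

datatype 'a fword = FWord (letters: "'a list")

instantiation fword :: (type) monoid_add
begin

definition "0 = FWord []"

definition "v + w = FWord (letters v @ letters w)"

instance
  by standard (simp_all add: zero_fword_def plus_fword_def)

end

text \<open>
  The free algebra over \<open>\<complex>[h]\<close> on the letters \<open>(i, j, s)\<close>, standing for \<open>T_{i,j}^{s}\<close>; the
  elements of \<^typ>\<open>complex poly\<close> are polynomials in \<open>h\<close>.
\<close>

type_synonym free_alg = "(nat \<times> nat \<times> nat) fword \<Rightarrow>\<^sub>0 complex poly"

definition yconst :: "complex poly \<Rightarrow> free_alg" where
  "yconst p = Poly_Mapping.single 0 p"

definition hY :: free_alg where
  "hY = yconst [:0, 1:]"

text \<open>The coefficient of \<open>u\<^sup>-\<^sup>s\<close> in \<open>T_{i,j}(u)\<close>, including \<open>s = 0\<close>.\<close>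

definition tcoef :: "nat \<Rightarrow> nat \<Rightarrow> nat \<Rightarrow> free_alg" where
  "tcoef i j s =
     (if s = 0 then (if i = j then 1 else 0)
      else Poly_Mapping.single (FWord [(i, j, s)]) 1)"

definition free_carrier :: "nat \<Rightarrow> free_alg set" where
  "free_carrier N =
     {x. \<forall>w\<in>Poly_Mapping.keys x. set (letters w) \<subseteq> {1..N} \<times> {1..N} \<times> {1..}}"

text \<open>
  The coefficient of \<open>u\<^sup>-\<^sup>r v\<^sup>-\<^sup>s\<close> in
  \<open>(u - v)[T_{i,j}(u), T_{k,l}(v)] - (T_{k,j}(v) T_{i,l}(u) - T_{k,j}(u) T_{i,l}(v))\<close>.
  The remaining coefficients, with \<open>r = -1\<close> or \<open>s = -1\<close>, are commutators with \<open>0\<close> or \<open>1\<close>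
  and vanish identically.
\<close>

definition yang_rel :: "nat \<Rightarrow> nat \<Rightarrow> nat \<Rightarrow> nat \<Rightarrow> nat \<Rightarrow> nat \<Rightarrow> free_alg" where
  "yang_rel i j k l r s =
     (tcoef i j (Suc r) * tcoef k l s - tcoef k l s * tcoef i j (Suc r))
     - (tcoef i j r * tcoef k l (Suc s) - tcoef k l (Suc s) * tcoef i j r)
     - (tcoef k j s * tcoef i l r - tcoef k j r * tcoef i l s)"

definition yang_ideal :: "nat \<Rightarrow> free_alg set" where
  "yang_ideal N =
     genideal (ring_on (free_carrier N))
       {yang_rel i j k l r s | i j k l r s. {i, j, k, l} \<subseteq> {1..N}}"

text \<open>
  \<open>Y(gl_N) \<otimes> \<complex>[h]\<close>, as the \<open>\<complex>[h]\<close>-algebra with the generators and relations of \<open>Y(gl_N)\<close>,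
  and the class in it of an element of the free algebra.
\<close>

definition Yh :: "nat \<Rightarrow> free_alg set ring" where
  "Yh N = ring_on (free_carrier N) Quot yang_ideal N"

definition ycls :: "nat \<Rightarrow> free_alg \<Rightarrow> free_alg set" where
  "ycls N x = yang_ideal N +>\<^bsub>ring_on (free_carrier N)\<^esub> x"

definition Ytilde :: "nat \<Rightarrow> free_alg set set" where
  "Ytilde N =
     generate_ring (Yh N)
       (range (\<lambda>p. ycls N (yconst p)) \<union>
        {ycls N ((- hY) ^ (s - 1) * tcoef i j s) | i j s.
           i \<in> {1..N} \<and> j \<in> {1..N} \<and> s \<ge> 1})"

text \<open>
  The series \<open>T_{i,j}(-u/h - k)\<close> in \<open>u\<inverse>\<close>: the inverse of \<open>-u/h - k\<close> is \<open>-h / (u + k h)\<close>, and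
  the summands of \<open>T_{i,j}\<close> with \<open>s > m\<close> do not contribute to the coefficient of \<open>u\<^sup>-\<^sup>m\<close>.
\<close>

definition Tser :: "nat \<Rightarrow> nat \<Rightarrow> nat \<Rightarrow> free_alg fps" where
  "Tser i j k =
     Abs_fps (\<lambda>m. \<Sum>s=0..m.
       tcoef i j s * ((fps_const (- hY) * inv_u_minus (- (of_nat k * hY))) ^ s) $ m)"

text \<open>The quantum minor \<open>M_{I,J}(-u/h)\<close>, for increasing lists \<open>I\<close>, \<open>J\<close> of the same length.\<close>

definition Mser :: "nat list \<Rightarrow> nat list \<Rightarrow> free_alg fps" where
  "Mser I J =
     (\<Sum>\<sigma> | \<sigma> permutes {0..<length I}.
        of_int (sign \<sigma>) * prod_list (map (\<lambda>k. Tser (I ! k) (J ! \<sigma> k) k) [0..<length I]))"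

text \<open>
  Division by \<open>h\<close>; the free algebra has no \<open>h\<close>-torsion. The coefficients of the off-diagonal
  quantum minors below are divisible by \<open>h\<close>.
\<close>

definition div_h :: "free_alg \<Rightarrow> free_alg" where
  "div_h x = (THE y. hY * y = x)"

definition A_ser :: "nat \<Rightarrow> free_alg fps" where
  "A_ser p = Mser [1..<Suc p] [1..<Suc p]"

text \<open>The series \<open>A_p(u)\<close> has constant term \<open>1\<close>, so the one-sided inverse is two-sided.\<close>

definition E_ser :: "nat \<Rightarrow> free_alg fps" where
  "E_ser p = Abs_fps (\<lambda>s. - div_h
     ((Mser ([1..<p] @ [Suc p]) [1..<Suc p] * fps_right_inverse (A_ser p) 1) $ s))"

definition F_ser :: "nat \<Rightarrow> free_alg fps" where
  "F_ser p = Abs_fps (\<lambda>s. - div_h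
     ((fps_right_inverse (A_ser p) 1 * Mser [1..<Suc p] ([1..<p] @ [Suc p])) $ s))"


section \<open>Dynamical Hamiltonians\<close>

text \<open>The embedding of \<open>U(gl_N)\<close> is transposed: \<open>e_{i,j} \<mapsto> T_{j,i}^{1}\<close>.\<close>

definition e_gen :: "nat \<Rightarrow> nat \<Rightarrow> free_alg" where
  "e_gen i j = tcoef j i 1"

definition G_el :: "nat \<Rightarrow> nat \<Rightarrow> free_alg" where
  "G_el i j = e_gen i j * e_gen j i - e_gen i i"

definition X_inf :: "nat \<Rightarrow> free_alg" where
  "X_inf i =
     - hY * tcoef i i 2 + yconst [:0, 1/2:] * (e_gen i i * (e_gen i i - 1))
     + hY * (\<Sum>j=1..<i. G_el i j)"

definition G_lam :: "(nat \<Rightarrow> nat) \<Rightarrow> nat \<Rightarrow> nat \<Rightarrow> free_alg" where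
  "G_lam lam i j =
     (if lam i \<ge> lam j then e_gen j i * e_gen i j else e_gen i j * e_gen j i)"

definition X_q :: "nat \<Rightarrow> (nat \<Rightarrow> complex) \<Rightarrow> (nat \<Rightarrow> nat) \<Rightarrow> nat \<Rightarrow> free_alg" where
  "X_q N q lam i =
     X_inf i
     - hY * (\<Sum>j=1..<i. yconst [:q i / (q i - q j):] * G_lam lam i j)
     - hY * (\<Sum>j=Suc i..N. yconst [:q j / (q i - q j):] * G_lam lam i j)"


section \<open>Equivariant cohomology of the cotangent bundles of partial flag varieties\<close>

text \<open>
  The variables \<open>\<gamma>_{a,i}\<close>, \<open>z_a\<close>, \<open>h\<close>. The linear order is immaterial; the library requires one
  in order to see that polynomials form an integral domain.
\<close>

datatype pvar = Gam nat nat | Zv nat | Hv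

instance pvar :: countable
  by countable_datatype

instantiation pvar :: linorder
begin

definition "(x::pvar) \<le> y \<longleftrightarrow> to_nat x \<le> to_nat y"

definition "(x::pvar) < y \<longleftrightarrow> to_nat x < to_nat y"

instance
  by standard (auto simp: less_eq_pvar_def less_pvar_def)

end

type_synonym mpol = "(pvar \<Rightarrow>\<^sub>0 nat) \<Rightarrow>\<^sub>0 complex"

definition pconst :: "complex \<Rightarrow> mpol" where
  "pconst c = Poly_Mapping.single 0 c"

definition pv :: "pvar \<Rightarrow> mpol" where
  "pv v = Poly_Mapping.single (Poly_Mapping.single v 1) 1"

definition rename :: "(pvar \<Rightarrow> pvar) \<Rightarrow> mpol \<Rightarrow> mpol" where
  "rename r f =
     (\<Sum>m\<in>Poly_Mapping.keys f. pconst (Poly_Mapping.lookup f m) *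
        (\<Prod>v\<in>Poly_Mapping.keys m. pv (r v) ^ Poly_Mapping.lookup m v))"

definition polys_in :: "pvar set \<Rightarrow> mpol set" where
  "polys_in V = {f. \<forall>m\<in>Poly_Mapping.keys f. Poly_Mapping.keys m \<subseteq> V}"

text \<open>
  The vectors \<open>\<lambda> \<in> \<int>_{\<ge>0}^N\<close> with \<open>|\<lambda>| = n\<close>, indexed by \<open>1, \<dots>, N\<close> and extended by \<open>0\<close>.
\<close>

definition comps :: "nat \<Rightarrow> nat \<Rightarrow> (nat \<Rightarrow> nat) set" where
  "comps N n = {lam. (\<forall>i. i \<notin> {1..N} \<longrightarrow> lam i = 0) \<and> (\<Sum>i=1..N. lam i) = n}"

definition base_vars :: "nat \<Rightarrow> pvar set" where
  "base_vars n = Zv ` {1..n} \<union> {Hv}"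

definition sym_polys :: "nat \<Rightarrow> nat \<Rightarrow> (nat \<Rightarrow> nat) \<Rightarrow> mpol set" where
  "sym_polys N n lam =
     {f \<in> polys_in ({Gam a j | a j. a \<in> {1..N} \<and> j \<in> {1..lam a}} \<union> base_vars n).
        \<forall>a\<in>{1..N}. \<forall>\<pi>. \<pi> permutes {1..lam a} \<longrightarrow>
          rename (\<lambda>v. case v of Gam b j \<Rightarrow> if b = a then Gam a (\<pi> j) else Gam b j | _ \<Rightarrow> v) f
          = f}"

definition coh_rel :: "nat \<Rightarrow> nat \<Rightarrow> (nat \<Rightarrow> nat) \<Rightarrow> mpol poly" where
  "coh_rel N n lam =
     (\<Prod>a=1..N. \<Prod>j=1..lam a. [:- pv (Gam a j), 1:]) - (\<Prod>b=1..n. [:- pv (Zv b), 1:])"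

definition coh_ideal :: "nat \<Rightarrow> nat \<Rightarrow> (nat \<Rightarrow> nat) \<Rightarrow> mpol set" where
  "coh_ideal N n lam =
     genideal (ring_on (sym_polys N n lam)) (range (Polynomial.coeff (coh_rel N n lam)))"

definition HT :: "nat \<Rightarrow> nat \<Rightarrow> (nat \<Rightarrow> nat) \<Rightarrow> mpol set ring" where
  "HT N n lam = ring_on (sym_polys N n lam) Quot coh_ideal N n lam"

definition hcls :: "nat \<Rightarrow> nat \<Rightarrow> (nat \<Rightarrow> nat) \<Rightarrow> mpol \<Rightarrow> mpol set" where
  "hcls N n lam f = coh_ideal N n lam +>\<^bsub>ring_on (sym_polys N n lam)\<^esub> f"

text \<open>The direct sum over \<open>|\<lambda>| = n\<close>; elements are families indexed by \<^term>\<open>comps N n\<close>.\<close>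

type_synonym coh_family = "(nat \<Rightarrow> nat) \<Rightarrow> mpol set"

definition HX :: "nat \<Rightarrow> nat \<Rightarrow> coh_family set" where
  "HX N n = (\<Pi>\<^sub>E lam\<in>comps N n. carrier (HT N n lam))"

definition HX_zero :: "nat \<Rightarrow> nat \<Rightarrow> coh_family" where
  "HX_zero N n = (\<lambda>lam\<in>comps N n. \<zero>\<^bsub>HT N n lam\<^esub>)"

definition HX_add :: "nat \<Rightarrow> nat \<Rightarrow> coh_family \<Rightarrow> coh_family \<Rightarrow> coh_family" where
  "HX_add N n v w = (\<lambda>lam\<in>comps N n. v lam \<oplus>\<^bsub>HT N n lam\<^esub> w lam)"

definition HX_scale :: "nat \<Rightarrow> nat \<Rightarrow> mpol \<Rightarrow> coh_family \<Rightarrow> coh_family" where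
  "HX_scale N n c v = (\<lambda>lam\<in>comps N n. hcls N n lam c \<otimes>\<^bsub>HT N n lam\<^esub> v lam)"

definition HX_incl :: "nat \<Rightarrow> nat \<Rightarrow> (nat \<Rightarrow> nat) \<Rightarrow> mpol set \<Rightarrow> coh_family" where
  "HX_incl N n lam x =
     (\<lambda>mu\<in>comps N n. if mu = lam then x else \<zero>\<^bsub>HT N n mu\<^esub>)"


section \<open>The Yangian action\<close>

definition move_unit :: "nat \<Rightarrow> nat \<Rightarrow> (nat \<Rightarrow> nat) \<Rightarrow> nat \<Rightarrow> nat" where
  "move_unit a b mu = mu(a := mu a - 1, b := mu b + 1)"

text \<open>
  The substitution replacing \<open>\<Gamma>\<close> by the result of moving \<open>\<gamma>_{a,i}\<close> from \<open>\<Gamma>_a\<close> to the end of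
  \<open>\<Gamma>_b\<close>, where \<open>\<Gamma>\<close> has group sizes \<open>lam\<close>; the variables left in \<open>\<Gamma>_a\<close> are renumbered.
\<close>

definition move_var :: "(nat \<Rightarrow> nat) \<Rightarrow> nat \<Rightarrow> nat \<Rightarrow> nat \<Rightarrow> pvar \<Rightarrow> pvar" where
  "move_var lam a i b v = (case v of
     Gam c j \<Rightarrow>
       if c = a then Gam a (if j < i then j else Suc j)
       else if c = b \<and> j = Suc (lam b) then Gam a i
       else Gam c j
   | _ \<Rightarrow> v)"

definition to_frac :: "mpol \<Rightarrow> mpol fract" where
  "to_frac f = Fract f 1"

definition A_fun :: "(nat \<Rightarrow> nat) \<Rightarrow> nat \<Rightarrow> mpol \<Rightarrow> mpol fps" where
  "A_fun lam p f =
     fps_const f *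
     (\<Prod>a=1..p. \<Prod>i=1..lam a. 1 - fps_const (pv Hv) * inv_u_minus (pv (Gam a i)))"

text \<open>
  In the next two definitions \<open>lam\<close> is the index of the target of the operator; the
  coefficients, a priori rational functions, are polynomials.
\<close>

definition E_fun :: "(nat \<Rightarrow> nat) \<Rightarrow> nat \<Rightarrow> mpol \<Rightarrow> mpol fract fps" where
  "E_fun lam p f =
     (\<Sum>i=1..lam p.
        fps_const
          (to_frac (rename (move_var lam p i (Suc p)) f) *
           (\<Prod>j\<in>{1..lam p} - {i}. 1 / to_frac (pv (Gam p j) - pv (Gam p i))) *
           (\<Prod>k=1..lam (Suc p). to_frac (pv (Gam p i) - pv (Gam (Suc p) k) - pv Hv))) *
        inv_u_minus (to_frac (pv (Gam p i))))"

definition F_fun :: "(nat \<Rightarrow> nat) \<Rightarrow> nat \<Rightarrow> mpol \<Rightarrow> mpol fract fps" where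
  "F_fun lam p f =
     (\<Sum>i=1..lam (Suc p).
        fps_const
          (to_frac (rename (move_var lam (Suc p) i p) f) *
           (\<Prod>j\<in>{1..lam (Suc p)} - {i}. 1 / to_frac (pv (Gam (Suc p) i) - pv (Gam (Suc p) j))) *
           (\<Prod>k=1..lam p. to_frac (pv (Gam p k) - pv (Gam (Suc p) i) - pv Hv))) *
        inv_u_minus (to_frac (pv (Gam (Suc p) i))))"

text \<open>
  \<open>rho\<close> is the \<^const>\<open>Ytilde\<close>-module structure on \<^const>\<open>HX\<close> in which \<open>\<complex>[h]\<close> acts by
  multiplication and the series \<open>A_p(u)\<close>, \<open>E_p(u)\<close>, \<open>F_p(u)\<close> act, coefficient by coefficient,
  by the given formulas. These determine \<open>rho y v\<close> for \<open>y\<close> in \<^const>\<open>Ytilde\<close> and \<open>v\<close> in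
  \<^const>\<open>HX\<close>; other values are irrelevant.
\<close>

locale yangian_action =
  fixes N n :: nat
    and rho :: "free_alg set \<Rightarrow> coh_family \<Rightarrow> coh_family"
  assumes rho_closed:
      "\<lbrakk>y \<in> Ytilde N; v \<in> HX N n\<rbrakk> \<Longrightarrow> rho y v \<in> HX N n"
    and rho_add_right:
      "\<lbrakk>y \<in> Ytilde N; v \<in> HX N n; w \<in> HX N n\<rbrakk> \<Longrightarrow>
         rho y (HX_add N n v w) = HX_add N n (rho y v) (rho y w)"
    and rho_add_left:
      "\<lbrakk>x \<in> Ytilde N; y \<in> Ytilde N; v \<in> HX N n\<rbrakk> \<Longrightarrow>
         rho (x \<oplus>\<^bsub>Yh N\<^esub> y) v = HX_add N n (rho x v) (rho y v)"
    and rho_mult: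
      "\<lbrakk>x \<in> Ytilde N; y \<in> Ytilde N; v \<in> HX N n\<rbrakk> \<Longrightarrow>
         rho (x \<otimes>\<^bsub>Yh N\<^esub> y) v = rho x (rho y v)"
    and rho_one:
      "v \<in> HX N n \<Longrightarrow> rho \<one>\<^bsub>Yh N\<^esub> v = v"
    and rho_const:
      "v \<in> HX N n \<Longrightarrow>
         rho (ycls N (yconst c)) v = HX_scale N n (poly (map_poly pconst c) (pv Hv)) v"
    and rho_A:
      "\<lbrakk>p \<in> {1..N}; mu \<in> comps N n; f \<in> sym_polys N n mu\<rbrakk> \<Longrightarrow>
         rho (ycls N (A_ser p $ s)) (HX_incl N n mu (hcls N n mu f))
         = HX_incl N n mu (hcls N n mu (A_fun mu p f $ s))"
    and rho_E_zero:
      "\<lbrakk>p \<in> {1..<N}; mu \<in> comps N n; f \<in> sym_polys N n mu; mu (Suc p) = 0\<rbrakk> \<Longrightarrow>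
         rho (ycls N (E_ser p $ s)) (HX_incl N n mu (hcls N n mu f)) = HX_zero N n"
    and rho_E:
      "\<lbrakk>p \<in> {1..<N}; mu \<in> comps N n; f \<in> sym_polys N n mu; mu (Suc p) \<noteq> 0;
        lam = move_unit (Suc p) p mu\<rbrakk> \<Longrightarrow>
         \<exists>g\<in>sym_polys N n lam. to_frac g = E_fun lam p f $ s \<and>
           rho (ycls N (E_ser p $ s)) (HX_incl N n mu (hcls N n mu f))
           = HX_incl N n lam (hcls N n lam g)"
    and rho_F_zero:
      "\<lbrakk>p \<in> {1..<N}; mu \<in> comps N n; f \<in> sym_polys N n mu; mu p = 0\<rbrakk> \<Longrightarrow>
         rho (ycls N (F_ser p $ s)) (HX_incl N n mu (hcls N n mu f)) = HX_zero N n"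
    and rho_F:
      "\<lbrakk>p \<in> {1..<N}; mu \<in> comps N n; f \<in> sym_polys N n mu; mu p \<noteq> 0;
        lam = move_unit p (Suc p) mu\<rbrakk> \<Longrightarrow>
         \<exists>g\<in>sym_polys N n lam. to_frac g = F_fun lam p f $ s \<and>
           rho (ycls N (F_ser p $ s)) (HX_incl N n mu (hcls N n mu f))
           = HX_incl N n lam (hcls N n lam g)"


section \<open>Quantum multiplication by divisors\<close>

definition D_cls :: "nat \<Rightarrow> nat \<Rightarrow> (nat \<Rightarrow> nat) \<Rightarrow> nat \<Rightarrow> mpol set" where
  "D_cls N n lam i = hcls N n lam (\<Sum>j=1..lam i. pv (Gam i j))"

text \<open>
  The operator on the summand of index \<open>lam\<close> induced by \<open>rho (e_{j,k} e_{k,j})\<close>, which has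
  weight zero and hence preserves this summand.
\<close>

definition ee_op ::
  "nat \<Rightarrow> nat \<Rightarrow> (free_alg set \<Rightarrow> coh_family \<Rightarrow> coh_family) \<Rightarrow> (nat \<Rightarrow> nat) \<Rightarrow>
   nat \<Rightarrow> nat \<Rightarrow> mpol set \<Rightarrow> mpol set" where
  "ee_op N n rho lam j k x =
     rho (ycls N (e_gen j k * e_gen k j)) (HX_incl N n lam x) lam"

text \<open>
  The operator \<open>D_i *\<close> of quantum multiplication with parameters \<open>qt\<close>, in the
  Maulik--Okounkov description: the scalar operator \<open>C\<close> is multiplication by some \<open>c\<close> in
  \<open>H_T(pt) = \<complex>[z; h]\<close>, and is determined by the last condition.
\<close>

definition quantum_mult ::
  "nat \<Rightarrow> nat \<Rightarrow> (free_alg set \<Rightarrow> coh_family \<Rightarrow> coh_family) \<Rightarrow> (nat \<Rightarrow> complex) \<Rightarrow>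
   (nat \<Rightarrow> nat) \<Rightarrow> nat \<Rightarrow> mpol set \<Rightarrow> mpol set" where
  "quantum_mult N n rho qt lam i =
     (let H = HT N n lam;
          D = D_cls N n lam i;
          hc = (\<lambda>r. hcls N n lam (pconst r * pv Hv))
      in THE Q. Q \<in> extensional (carrier H) \<and>
           (\<exists>c\<in>polys_in (base_vars n). \<forall>x\<in>carrier H.
              Q x =
                D \<otimes>\<^bsub>H\<^esub> x
                \<oplus>\<^bsub>H\<^esub> (\<Oplus>\<^bsub>H\<^esub>j\<in>{1..<i}.
                      hc ((qt j / qt i) / (1 - qt j / qt i)) \<otimes>\<^bsub>H\<^esub> ee_op N n rho lam j i x)
                \<ominus>\<^bsub>H\<^esub> (\<Oplus>\<^bsub>H\<^esub>j\<in>{Suc i..N}.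
                      hc ((qt i / qt j) / (1 - qt i / qt j)) \<otimes>\<^bsub>H\<^esub> ee_op N n rho lam i j x)
                \<oplus>\<^bsub>H\<^esub> hcls N n lam c \<otimes>\<^bsub>H\<^esub> x) \<and>
           Q \<one>\<^bsub>H\<^esub> \<ominus>\<^bsub>H\<^esub> D \<otimes>\<^bsub>H\<^esub> \<one>\<^bsub>H\<^esub> = \<zero>\<^bsub>H\<^esub>)"

end

theory Submission
  imports Defs
begin

text \<open>
  Comparing the coefficients of \<open>u\<^sup>-\<^sup>2\<close> in \<open>A_i(u)\<close> and \<open>A_{i-1}(u)\<close> shows that \<open>X_i\<^sup>\<infinity>\<close> acts on
  the summand of index \<open>\<lambda>\<close> as multiplication by \<open>D_i\<close>; the division by \<open>h\<close> involved is harmless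
  because the relations of the cohomology ring do not contain \<open>h\<close>.
  With \<open>q = qt\<^sup>-\<^sup>1\<close> the remaining part of \<open>X\<^sup>q\<close> agrees with the quantum part of \<open>D_i *\<close> up to a
  scalar, because \<open>e_{i,j} e_{j,i} - e_{j,i} e_{i,j} = e_{i,i} - e_{j,j}\<close> acts by \<open>\<lambda>_i - \<lambda>_j\<close>.
  The scalar is the right one because \<open>e_{i,j}\<close> shifts polynomial degrees by
  \<open>\<lambda>_j - \<lambda>_i - 1\<close>, so that it kills \<open>1\<close> when \<open>\<lambda>_i \<ge> \<lambda>_j\<close>; hence every
  \<open>G_{\<lambda>,i,j}\<close> kills \<open>1\<close>.
\<close>

section \<open>Quotients by generated ideals\<close>

text \<open>\<open>rho\<close> is prescribed on classes of polynomials, and only for the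
  coefficients of \<open>A_p\<close>, \<open>E_p\<close>, \<open>F_p\<close>. Everything is
  therefore tracked on representatives by the relation \<open>acts\<close>, and degrees are taken of
  these polynomials, so that no grading on the quotient ring has to be set up.

  The shape of \<open>X_inf\<close> comes from expanding quantum minors. At order
  \<open>u^-2\<close> of \<open>A_p\<close> only the identity and the transpositions survive, and
  index \<open>i\<close> contributes \<open>h * Z_el i\<close>. Adding \<open>Z_el i\<close> to
  \<open>X_inf i\<close> cancels \<open>T_{i,i}^{2}\<close> and all products
  \<open>e_{i,k} e_{k,i}\<close> already in the free algebra. What is left involves only weights,
  and \<open>(L + m choose 2) - (L choose 2) = (m choose 2) + L m\<close> matches it with the
  \<open>h\<close>-part of the action of \<open>Z_el i\<close>.

  Only simple root vectors are given by \<open>E_p\<close> and \<open>F_p\<close>; the others are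
  commutators \<open>[e_{i,k}, e_{k,j}]\<close>. The degree shift \<open>lam_j - lam_i - 1\<close>
  is stable under this because the unit already moved into or out of group \<open>k\<close> makes up
  for one of the two \<open>- 1\<close>.

  The constant in \<open>C\<close> is determined only modulo the relations, so uniqueness is proved
  for the operator, not for the polynomial.\<close>

locale genideal_quotient =
  fixes S B :: "'a::ring_1 set"
  assumes one_mem: "1 \<in> S"
    and diff_mem: "\<And>x y. x \<in> S \<Longrightarrow> y \<in> S \<Longrightarrow> x - y \<in> S"
    and mult_mem: "\<And>x y. x \<in> S \<Longrightarrow> y \<in> S \<Longrightarrow> x * y \<in> S"
    and gens: "B \<subseteq> S"
begin

text \<open>Commutativity is not assumed, so the same facts serve \<open>Yh\<close> over the free
  algebra and \<open>HT\<close> over the symmetric polynomials; both interpretations rewrite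
  \<open>I\<close>, \<open>Q\<close>, \<open>cls\<close> into the given ideal, quotient and class
  map.\<close>

definition I where "I = genideal (ring_on S) B"
definition Q where "Q = ring_on S Quot I"
definition cls where "cls x = I +>\<^bsub>ring_on S\<^esub> x"

lemma zero_mem: "0 \<in> S"
  using diff_mem[OF one_mem one_mem] by simp

lemma uminus_mem: "x \<in> S \<Longrightarrow> - x \<in> S"
  using diff_mem[OF zero_mem] by fastforce

lemma add_mem: "x \<in> S \<Longrightarrow> y \<in> S \<Longrightarrow> x + y \<in> S"
  using diff_mem[OF _ uminus_mem] by fastforce

lemma sum_mem: "(\<And>i. i \<in> A \<Longrightarrow> f i \<in> S) \<Longrightarrow> sum f A \<in> S"
  by (induction A rule: infinite_finite_induct) (auto simp: zero_mem add_mem)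

lemma power_mem: "x \<in> S \<Longrightarrow> x ^ k \<in> S"
  by (induction k) (auto simp: one_mem mult_mem)

lemma of_nat_mem: "of_nat k \<in> S"
  by (induction k) (auto simp: zero_mem one_mem add_mem)

lemma ring_on: "ring (ring_on S)"
proof (rule ringI)
  show "abelian_group (ring_on S)"
    by (rule abelian_groupI)
      (auto simp: ring_on_def zero_mem add_mem ac_simps
        intro!: bexI[of _ "- x" for x] uminus_mem)
  show "Group.monoid (ring_on S)"
    by (rule monoidI) (auto simp: ring_on_def one_mem mult_mem mult.assoc)
qed (auto simp: ring_on_def algebra_simps)

lemma carrier_ring_on: "carrier (ring_on S) = S"
  by (simp add: ring_on_def)

lemma ideal: "ideal I (ring_on S)"
  unfolding I_def by (rule ring.genideal_ideal[OF ring_on]) (simp add: carrier_ring_on gens)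

lemma I_subset: "I \<subseteq> S"
  using ideal.Icarr[OF ideal] by (auto simp: carrier_ring_on)

lemma gens_subset_I: "B \<subseteq> I"
  unfolding I_def by (rule ring.genideal_self[OF ring_on]) (simp add: carrier_ring_on gens)

lemma a_inv_ring_on: "x \<in> S \<Longrightarrow> \<ominus>\<^bsub>ring_on S\<^esub> x = - x"
  using ring_on abelian_group.minus_equality[OF ring.is_abelian_group[OF ring_on], of "- x" x]
  by (simp add: carrier_ring_on uminus_mem) (simp add: ring_on_def)

lemma zero_mem_I: "0 \<in> I"
  using additive_subgroup.zero_closed[OF ideal.axioms(1)[OF ideal]] by (simp add: ring_on_def)

lemma add_mem_I: "x \<in> I \<Longrightarrow> y \<in> I \<Longrightarrow> x + y \<in> I"
  using additive_subgroup.a_closed[OF ideal.axioms(1)[OF ideal], of x y] by (simp add: ring_on_def)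

lemma mult_left_mem_I: "x \<in> I \<Longrightarrow> y \<in> S \<Longrightarrow> y * x \<in> I"
  using ideal.I_l_closed[OF ideal, of x y] by (simp add: ring_on_def)

lemma mult_right_mem_I: "x \<in> I \<Longrightarrow> y \<in> S \<Longrightarrow> x * y \<in> I"
  using ideal.I_r_closed[OF ideal, of x y] by (simp add: ring_on_def)

lemma uminus_mem_I: "x \<in> I \<Longrightarrow> - x \<in> I"
  using mult_left_mem_I[of x "- 1"] uminus_mem[OF one_mem] by simp

text \<open>Induction over the generated ideal. Closure of \<open>J\<close> under negation comes
  from absorbing \<open>- 1\<close>.\<close>

lemma I_minimal:
  assumes J: "B \<subseteq> J" "J \<subseteq> S" "0 \<in> J" "\<And>x y. x \<in> J \<Longrightarrow> y \<in> J \<Longrightarrow> x + y \<in> J"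
    and l: "\<And>x y. x \<in> J \<Longrightarrow> y \<in> S \<Longrightarrow> y * x \<in> J"
    and r: "\<And>x y. x \<in> J \<Longrightarrow> y \<in> S \<Longrightarrow> x * y \<in> J"
  shows "I \<subseteq> J"
  unfolding I_def
proof (rule ring.genideal_minimal[OF ring_on _ J(1)], rule idealI[OF ring_on])
  have inv: "- x \<in> J" if "x \<in> J" for x
    using l[OF that, of "- 1"] uminus_mem[OF one_mem] by simp
  show "subgroup J (add_monoid (ring_on S))"
  proof
    fix x assume x: "x \<in> J"
    then have "x \<in> S" using J by auto
    then show "inv\<^bsub>add_monoid (ring_on S)\<^esub> x \<in> J"
      using a_inv_ring_on[of x] inv[OF x] by (simp add: a_inv_def)
  qed (use J in \<open>auto simp: ring_on_def\<close>)
qed (use l r in \<open>auto simp: ring_on_def\<close>)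

lemma hom: "cls \<in> ring_hom (ring_on S) Q"
  unfolding cls_def Q_def using ideal.rcos_ring_hom[OF ideal] by simp

lemma ring_Q: "ring Q"
  unfolding Q_def by (rule ideal.quotient_is_ring[OF ideal])

lemma cls_add: "x \<in> S \<Longrightarrow> y \<in> S \<Longrightarrow> cls x \<oplus>\<^bsub>Q\<^esub> cls y = cls (x + y)"
  using ring_hom_add[OF hom, of x y] by (simp add: ring_on_def)

lemma cls_mult: "x \<in> S \<Longrightarrow> y \<in> S \<Longrightarrow> cls x \<otimes>\<^bsub>Q\<^esub> cls y = cls (x * y)"
  using ring_hom_mult[OF hom, of x y] by (simp add: ring_on_def)

lemma cls_one: "\<one>\<^bsub>Q\<^esub> = cls 1"
  using ring_hom_one[OF hom] by (simp add: ring_on_def)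

lemma cls_closed: "x \<in> S \<Longrightarrow> cls x \<in> carrier Q"
  using ring_hom_closed[OF hom, of x] by (simp add: ring_on_def)

lemma cls_zero: "\<zero>\<^bsub>Q\<^esub> = cls 0"
  using ring_hom_zero[OF hom ring_on ring_Q] by (simp add: ring_on_def)

lemma cls_uminus: "x \<in> S \<Longrightarrow> \<ominus>\<^bsub>Q\<^esub> cls x = cls (- x)"
  using ring_hom_ring.axioms abelian_group.minus_equality[OF ring.is_abelian_group[OF ring_Q], of "cls (- x)" "cls x"]
  by (simp add: cls_closed uminus_mem cls_add cls_zero)

lemma cls_diff: "x \<in> S \<Longrightarrow> y \<in> S \<Longrightarrow> cls x \<ominus>\<^bsub>Q\<^esub> cls y = cls (x - y)"
  by (simp add: a_minus_def cls_uminus cls_add uminus_mem)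

lemma carrier_Q: "carrier Q = cls ` S"
  by (auto simp: Q_def cls_def FactRing_def A_RCOSETS_def' carrier_ring_on)

lemma cls_eq_iff: "x \<in> S \<Longrightarrow> y \<in> S \<Longrightarrow> cls x = cls y \<longleftrightarrow> x - y \<in> I"
  using ring.quotient_eq_iff_same_a_r_cos[OF ring_on ideal, of x y]
  by (simp add: carrier_ring_on cls_def a_minus_def a_inv_ring_on) (simp add: ring_on_def)

lemma cls_sum:
  "finite A \<Longrightarrow> (\<And>j. j \<in> A \<Longrightarrow> f j \<in> S) \<Longrightarrow> (\<Oplus>\<^bsub>Q\<^esub>j\<in>A. cls (f j)) = cls (\<Sum>j\<in>A. f j)"
proof (induction A rule: finite_induct)
  case empty
  interpret ring Q by (rule ring_Q)
  show ?case by (simp add: cls_zero)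
next
  case (insert a A)
  interpret ring Q by (rule ring_Q)
  have "(\<Oplus>\<^bsub>Q\<^esub>j\<in>insert a A. cls (f j)) = cls (f a) \<oplus>\<^bsub>Q\<^esub> (\<Oplus>\<^bsub>Q\<^esub>j\<in>A. cls (f j))"
    using insert by (intro finsum_insert) (auto simp: cls_closed)
  then show ?case
    using insert by (simp add: cls_add sum_mem)
qed

end

section \<open>Polynomials\<close>

lemma poly_mapping_induct [case_names zero single add]:
  assumes "P 0" "\<And>k v. P (Poly_Mapping.single k v)" "\<And>f g. P f \<Longrightarrow> P g \<Longrightarrow> P (f + g)"
  shows "P f"
proof (induction f rule: update_induct)
  case const
  show ?case by fact
next
  case (update f a b)
  have "Poly_Mapping.update a b f = f + Poly_Mapping.single a b"
    using update by (intro poly_mapping_eqI)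
      (auto simp: Poly_Mapping.lookup_update Poly_Mapping.lookup_add lookup_single in_keys_iff when_def)
  then show ?case
    using assms(2,3) update by simp
qed

section \<open>Substitution homomorphisms on polynomials\<close>

definition mon_eval :: "(pvar \<Rightarrow> 'b::comm_ring_1) \<Rightarrow> (pvar \<Rightarrow>\<^sub>0 nat) \<Rightarrow> 'b" where
  "mon_eval r m = (\<Prod>v\<in>Poly_Mapping.keys m. r v ^ Poly_Mapping.lookup m v)"

text \<open>Kept general in the target ring so that one proof of multiplicativity covers both
  \<open>rename\<close>, with values in \<open>mpol\<close>, and the degree substitution
  \<open>grade\<close>, with values in \<open>mpol poly\<close>.\<close>

definition mpol_eval :: "(complex \<Rightarrow> 'b::comm_ring_1) \<Rightarrow> (pvar \<Rightarrow> 'b) \<Rightarrow> mpol \<Rightarrow> 'b" where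
  "mpol_eval c r f = (\<Sum>m\<in>Poly_Mapping.keys f. c (Poly_Mapping.lookup f m) * mon_eval r m)"

lemma mon_eval_superset:
  "finite A \<Longrightarrow> Poly_Mapping.keys m \<subseteq> A \<Longrightarrow> mon_eval r m = (\<Prod>v\<in>A. r v ^ Poly_Mapping.lookup m v)"
  unfolding mon_eval_def by (rule prod.mono_neutral_left) (auto simp: in_keys_iff)

lemma mon_eval_add: "mon_eval r (m + m') = mon_eval r m * mon_eval r m'"
proof -
  let ?A = "Poly_Mapping.keys m \<union> Poly_Mapping.keys m'"
  have "mon_eval r (m + m') = (\<Prod>v\<in>?A. r v ^ Poly_Mapping.lookup (m + m') v)"
    by (rule mon_eval_superset) (auto simp: Poly_Mapping.keys_add)
  also have "\<dots> = mon_eval r m * mon_eval r m'"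
    by (simp add: mon_eval_superset[of ?A] Poly_Mapping.lookup_add power_add prod.distrib)
  finally show ?thesis .
qed

locale coeff_hom =
  fixes c :: "complex \<Rightarrow> 'b::comm_ring_1"
  assumes c_add: "c (x + y) = c x + c y"
    and c_mult: "c (x * y) = c x * c y"
    and c_one: "c 1 = 1"
begin

lemma c_zero: "c 0 = 0"
  using c_add[of 0 0] by simp

lemma eval_superset:
  "finite A \<Longrightarrow> Poly_Mapping.keys f \<subseteq> A \<Longrightarrow>
     mpol_eval c r f = (\<Sum>m\<in>A. c (Poly_Mapping.lookup f m) * mon_eval r m)"
  unfolding mpol_eval_def by (rule sum.mono_neutral_left) (auto simp: in_keys_iff c_zero)

lemma eval_add: "mpol_eval c r (f + g) = mpol_eval c r f + mpol_eval c r g"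
proof -
  let ?A = "Poly_Mapping.keys f \<union> Poly_Mapping.keys g"
  have "mpol_eval c r (f + g) = (\<Sum>m\<in>?A. c (Poly_Mapping.lookup (f + g) m) * mon_eval r m)"
    by (rule eval_superset) (auto simp: Poly_Mapping.keys_add)
  also have "\<dots> = mpol_eval c r f + mpol_eval c r g"
    by (simp add: eval_superset[of ?A] Poly_Mapping.lookup_add sum.distrib c_add algebra_simps)
  finally show ?thesis .
qed

lemma eval_single: "mpol_eval c r (Poly_Mapping.single m a) = c a * mon_eval r m"
  by (cases "a = 0") (auto simp: mpol_eval_def c_zero)

lemma eval_zero: "mpol_eval c r 0 = 0"
  by (simp add: mpol_eval_def)

lemma eval_mult: "mpol_eval c r (f * g) = mpol_eval c r f * mpol_eval c r g"
proof (induction f rule: poly_mapping_induct)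
  case (single k v)
  show ?case
    by (induction g rule: poly_mapping_induct)
      (simp_all add: eval_zero mult_single eval_single c_mult mon_eval_add eval_add algebra_simps)
qed (simp_all add: eval_zero eval_add algebra_simps)

lemma eval_pconst: "mpol_eval c r (pconst a) = c a"
  by (simp add: pconst_def eval_single mon_eval_def)

lemma eval_one: "mpol_eval c r 1 = 1"
  using eval_pconst[of r 1] by (simp add: pconst_def c_one)

lemma eval_pv: "mpol_eval c r (pv v) = r v"
  by (simp add: pv_def eval_single mon_eval_def c_one)

end

lemma pconst_add: "pconst (x + y) = pconst x + pconst y"
  by (simp add: pconst_def Poly_Mapping.single_add)

lemma pconst_mult: "pconst (x * y) = pconst x * pconst y"
  by (simp add: pconst_def mult_single)

lemma pconst_one [simp]: "pconst 1 = 1"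
  by (simp add: pconst_def)

lemma pconst_zero [simp]: "pconst 0 = 0"
  by (simp add: pconst_def)

lemma pconst_of_nat: "pconst (of_nat k) = of_nat k"
  by (induction k) (simp_all add: pconst_add)

lemma pconst_uminus: "pconst (- x) = - pconst x"
  by (simp add: pconst_def single_uminus)

lemma pconst_diff: "pconst (x - y) = pconst x - pconst y"
  using pconst_add[of x "- y"] by (simp add: pconst_uminus)

text \<open>Reduces identities between ring homomorphisms on \<open>mpol\<close> to constants and
  variables.\<close>

lemma mpol_induct [case_names pconst pv add mult]:
  assumes c: "\<And>a. P (pconst a)" and v: "\<And>v. P (pv v)"
    and a: "\<And>f g. P f \<Longrightarrow> P g \<Longrightarrow> P (f + g)"
    and m: "\<And>f g. P f \<Longrightarrow> P g \<Longrightarrow> P (f * g)"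
  shows "P f"
proof (induction f rule: poly_mapping_induct)
  case zero
  show ?case using c[of 0] by simp
next
  case (single k x)
  have p: "P (pv v ^ j)" for v j
    using c[of 1] by (induction j) (auto intro: m v)
  have "P (Poly_Mapping.single k 1)"
  proof (induction k rule: poly_mapping_induct)
    case zero
    show ?case using c[of 1] by (simp add: pconst_def)
  next
    case (single v j)
    have "Poly_Mapping.single (Poly_Mapping.single v j) 1 = pv v ^ j"
    proof (induction j)
      case (Suc j)
      have "Poly_Mapping.single (Poly_Mapping.single v (Suc j)) 1 =
          pv v * Poly_Mapping.single (Poly_Mapping.single v j) 1"
        by (simp add: pv_def mult_single flip: Poly_Mapping.single_add)
      then show ?case
        by (simp add: Suc)
    qed simp
    then show ?case using p by simp
  next
    case (add f g)
    then have "P (Poly_Mapping.single f 1 * Poly_Mapping.single g 1)"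
      by (rule m)
    then show ?case by (simp add: mult_single)
  qed
  then have "P (pconst x * Poly_Mapping.single k 1)"
    using c m by blast
  then show ?case
    by (simp add: pconst_def mult_single)
qed (rule a)

lemma rename_eq_eval: "rename r = mpol_eval pconst (\<lambda>v. pv (r v))"
  by (rule ext) (simp add: rename_def mpol_eval_def mon_eval_def)

interpretation rename_hom: coeff_hom pconst
  by standard (simp_all add: pconst_add pconst_mult)

lemma rename_add: "rename r (f + g) = rename r f + rename r g"
  and rename_mult: "rename r (f * g) = rename r f * rename r g"
  and rename_pconst [simp]: "rename r (pconst a) = pconst a"
  and rename_pv [simp]: "rename r (pv v) = pv (r v)"
  and rename_zero [simp]: "rename r 0 = 0"
  and rename_one [simp]: "rename r 1 = 1"
  by (simp_all add: rename_eq_eval rename_hom.eval_add rename_hom.eval_mult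
      rename_hom.eval_pconst rename_hom.eval_pv rename_hom.eval_zero rename_hom.eval_one)

lemma rename_uminus: "rename r (- f) = - rename r f"
  using rename_add[of r f "- f"] by (simp add: eq_neg_iff_add_eq_0 add.commute)

lemma rename_diff: "rename r (f - g) = rename r f - rename r g"
  using rename_add[of r f "- g"] by (simp add: rename_uminus)

lemma rename_sum: "rename r (sum f A) = (\<Sum>a\<in>A. rename r (f a))"
  by (induction A rule: infinite_finite_induct) (simp_all add: rename_add)

text \<open>Total degree is measured by the substitution of \<open>v X\<close> for each variable \<open>v\<close>.\<close>

definition grade :: "mpol \<Rightarrow> mpol poly" where
  "grade = mpol_eval (\<lambda>a. [:pconst a:]) (\<lambda>v. [:0, pv v:])"

interpretation grade_hom: coeff_hom "\<lambda>a. [:pconst a:]"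
  by standard (simp_all add: pconst_add pconst_mult)

lemma grade_add: "grade (f + g) = grade f + grade g"
  and grade_mult: "grade (f * g) = grade f * grade g"
  and grade_pconst [simp]: "grade (pconst a) = [:pconst a:]"
  and grade_pv [simp]: "grade (pv v) = [:0, pv v:]"
  and grade_zero [simp]: "grade 0 = 0"
  and grade_one [simp]: "grade 1 = 1"
  by (simp_all add: grade_def grade_hom.eval_add grade_hom.eval_mult
      grade_hom.eval_pconst grade_hom.eval_pv grade_hom.eval_zero grade_hom.eval_one)

lemma grade_uminus: "grade (- f) = - grade f"
  using grade_add[of f "- f"] by (simp add: eq_neg_iff_add_eq_0 add.commute)

lemma grade_diff: "grade (f - g) = grade f - grade g"
  using grade_add[of f "- g"] by (simp add: grade_uminus)

text \<open>Setting \<open>X = 1\<close> undoes the substitution. Hence \<open>grade\<close> is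
  injective, and degrees of nonzero polynomials add as they do in the integral domain
  \<open>mpol poly\<close>.\<close>

lemma poly_grade: "poly (grade f) 1 = f"
  by (induction f rule: mpol_induct) (simp_all add: grade_add grade_mult)

lemma grade_eq_0_iff [simp]: "grade f = 0 \<longleftrightarrow> f = 0"
  using poly_grade[of f] by auto

lemma map_poly_rename_mult:
  "map_poly (rename r) (p * q) = map_poly (rename r) p * map_poly (rename r) q"
  by (rule poly_eqI) (simp add: coeff_map_poly coeff_mult rename_sum rename_mult)

lemma map_poly_rename_add:
  "map_poly (rename r) (p + q) = map_poly (rename r) p + map_poly (rename r) q"
  by (rule poly_eqI) (simp add: coeff_map_poly rename_add)

lemma grade_rename: "grade (rename r f) = map_poly (rename r) (grade f)"
  by (induction f rule: mpol_induct)
    (simp_all add: rename_add rename_mult grade_add grade_mult map_poly_rename_mult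
      map_poly_rename_add map_poly_pCons)

section \<open>Total degree of polynomials and of rational functions\<close>

definition tdeg :: "mpol \<Rightarrow> nat" where
  "tdeg f = degree (grade f)"

text \<open>The bound is an integer and \<open>0\<close> satisfies every bound, so a negative bound
  is meaningful and forces \<open>f = 0\<close>; with \<open>tdeg\<close> alone, zero could not be
  told from a constant.\<close>

definition tdeg_le :: "mpol \<Rightarrow> int \<Rightarrow> bool" where
  "tdeg_le f d \<longleftrightarrow> f = 0 \<or> int (tdeg f) \<le> d"

lemma tdeg_mult: "f \<noteq> 0 \<Longrightarrow> g \<noteq> 0 \<Longrightarrow> tdeg (f * g) = tdeg f + tdeg g"
  by (simp add: tdeg_def grade_mult degree_mult_eq)

lemma tdeg_le_mult: "tdeg_le f d \<Longrightarrow> tdeg_le g e \<Longrightarrow> tdeg_le (f * g) (d + e)"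
  by (cases "f = 0"; cases "g = 0") (auto simp: tdeg_le_def tdeg_mult)

lemma tdeg_le_add: "tdeg_le f d \<Longrightarrow> tdeg_le g d \<Longrightarrow> tdeg_le (f + g) d"
  using degree_add_le_max[of "grade f" "grade g"] by (auto simp: tdeg_le_def tdeg_def grade_add)

lemma tdeg_le_uminus: "tdeg_le f d \<Longrightarrow> tdeg_le (- f) d"
  by (auto simp: tdeg_le_def tdeg_def grade_uminus)

lemma tdeg_le_diff: "tdeg_le f d \<Longrightarrow> tdeg_le g d \<Longrightarrow> tdeg_le (f - g) d"
  using tdeg_le_add[of f d "- g"] by (simp add: tdeg_le_uminus)

text \<open>Renaming acts on the coefficients of \<open>grade f\<close>. It may lower the degree,
  when variables are identified, but never raises it.\<close>

lemma tdeg_le_rename: "tdeg_le f d \<Longrightarrow> tdeg_le (rename r f) d"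
  using map_poly_degree_leq[of "rename r" "grade f"]
  by (auto simp: tdeg_le_def tdeg_def grade_rename)

lemma tdeg_le_one: "tdeg_le 1 0"
  by (simp add: tdeg_le_def tdeg_def)

lemma tdeg_le_pv: "tdeg_le (pv v) 1"
  by (auto simp: tdeg_le_def tdeg_def)

lemma tdeg_le_neg: "tdeg_le f d \<Longrightarrow> d < 0 \<Longrightarrow> f = 0"
  by (auto simp: tdeg_le_def)

lemma tdeg_pv_diff: "v \<noteq> w \<Longrightarrow> pv v - pv w \<noteq> 0 \<and> tdeg (pv v - pv w) = 1"
proof -
  assume "v \<noteq> w"
  then have "Poly_Mapping.lookup (Poly_Mapping.single v (1::nat)) v \<noteq>
      Poly_Mapping.lookup (Poly_Mapping.single w 1) v"
    by (simp add: lookup_single)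
  then have "Poly_Mapping.single v (1::nat) \<noteq> Poly_Mapping.single w 1"
    by metis
  then have "Poly_Mapping.lookup (pv v - pv w) (Poly_Mapping.single v 1) \<noteq> 0"
    by (simp add: pv_def Poly_Mapping.lookup_minus lookup_single when_def)
  then have "pv v - pv w \<noteq> 0" by auto
  then show ?thesis by (simp add: tdeg_def grade_diff)
qed

text \<open>The bound \<open>deg a - deg b <= d\<close>. Since degrees add, it does not depend on
  the chosen fraction, so one representation suffices.\<close>

definition frac_tdeg_le :: "mpol fract \<Rightarrow> int \<Rightarrow> bool" where
  "frac_tdeg_le x d \<longleftrightarrow> (\<exists>a b. b \<noteq> 0 \<and> x = Fract a b \<and> tdeg_le a (d + int (tdeg b)))"

lemma frac_tdeg_le_to_frac: "tdeg_le f d \<Longrightarrow> frac_tdeg_le (to_frac f) d"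
  unfolding frac_tdeg_le_def to_frac_def by (intro exI[of _ f] exI[of _ 1]) (simp add: tdeg_def)

lemma frac_tdeg_le_mult:
  "frac_tdeg_le x d \<Longrightarrow> frac_tdeg_le y e \<Longrightarrow> frac_tdeg_le (x * y) (d + e)"
  unfolding frac_tdeg_le_def
proof (elim exE conjE)
  fix a b a' b'
  assume "b \<noteq> 0" "x = Fract a b" "tdeg_le a (d + int (tdeg b))"
    "b' \<noteq> 0" "y = Fract a' b'" "tdeg_le a' (e + int (tdeg b'))"
  then show "\<exists>a b. b \<noteq> 0 \<and> x * y = Fract a b \<and> tdeg_le a (d + e + int (tdeg b))"
    using tdeg_le_mult[of a "d + int (tdeg b)" a' "e + int (tdeg b')"]
    by (intro exI[of _ "a * a'"] exI[of _ "b * b'"]) (auto simp: tdeg_mult algebra_simps)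
qed

lemma frac_tdeg_le_add:
  "frac_tdeg_le x d \<Longrightarrow> frac_tdeg_le y d \<Longrightarrow> frac_tdeg_le (x + y) d"
  unfolding frac_tdeg_le_def
proof (elim exE conjE)
  fix a b a' b'
  assume *: "b \<noteq> 0" "x = Fract a b" "tdeg_le a (d + int (tdeg b))"
    "b' \<noteq> 0" "y = Fract a' b'" "tdeg_le a' (d + int (tdeg b'))"
  have "tdeg_le b (int (tdeg b))" "tdeg_le b' (int (tdeg b'))"
    by (auto simp: tdeg_le_def)
  then have "tdeg_le (a * b' + a' * b) (d + int (tdeg b) + int (tdeg b'))"
    using * by (intro tdeg_le_add)
      (metis tdeg_le_mult, metis tdeg_le_mult add.assoc add.commute)
  then show "\<exists>a b. b \<noteq> 0 \<and> x + y = Fract a b \<and> tdeg_le a (d + int (tdeg b))"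
    using * by (intro exI[of _ "a * b' + a' * b"] exI[of _ "b * b'"]) (auto simp: tdeg_mult add.assoc)
qed

lemma frac_tdeg_le_zero: "frac_tdeg_le 0 d"
  unfolding frac_tdeg_le_def by (intro exI[of _ 0] exI[of _ 1]) (simp add: tdeg_le_def fract_collapse)

lemma frac_tdeg_le_sum:
  "(\<And>i. i \<in> A \<Longrightarrow> frac_tdeg_le (f i) d) \<Longrightarrow> frac_tdeg_le (sum f A) d"
  by (induction A rule: infinite_finite_induct) (auto simp: frac_tdeg_le_zero frac_tdeg_le_add)

lemma frac_tdeg_le_prod:
  "finite A \<Longrightarrow> (\<And>i. i \<in> A \<Longrightarrow> frac_tdeg_le (f i) d) \<Longrightarrow>
     frac_tdeg_le (prod f A) (int (card A) * d)"
proof (induction A rule: finite_induct)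
  case empty
  show ?case using frac_tdeg_le_to_frac[OF tdeg_le_one]
    by (simp add: to_frac_def fract_collapse)
next
  case (insert a A)
  then have "frac_tdeg_le (f a * prod f A) (d + int (card A) * d)"
    by (intro frac_tdeg_le_mult) auto
  then show ?case using insert by (simp add: algebra_simps)
qed

lemma frac_tdeg_le_inverse_pv_diff:
  "v \<noteq> w \<Longrightarrow> frac_tdeg_le (1 / to_frac (pv v - pv w)) (- 1)"
  unfolding frac_tdeg_le_def to_frac_def
  by (intro exI[of _ 1] exI[of _ "pv v - pv w"])
    (use tdeg_pv_diff[of v w] tdeg_le_one in \<open>auto simp: One_fract_def divide_fract eq_fract\<close>)

text \<open>Clearing the denominator gives \<open>f * b = a\<close>, and degrees add. This brings
  bounds on the rational formulas of \<open>E_fun\<close> and \<open>F_fun\<close> back to the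
  polynomials they equal.\<close>

lemma tdeg_le_of_frac:
  assumes "frac_tdeg_le (to_frac f) d"
  shows "tdeg_le f d"
proof -
  obtain a b where ab: "b \<noteq> 0" "Fract f 1 = Fract a b" "tdeg_le a (d + int (tdeg b))"
    using assms by (auto simp: frac_tdeg_le_def to_frac_def)
  then have "f * b = a"
    by (simp add: eq_fract)
  then show ?thesis
    using ab by (cases "f = 0") (auto simp: tdeg_le_def tdeg_mult)
qed

section \<open>Cohomology\<close>

lemma polys_in_mono: "V \<subseteq> W \<Longrightarrow> f \<in> polys_in V \<Longrightarrow> f \<in> polys_in W"
  by (auto simp: polys_in_def)

lemma polys_in_zero [simp]: "0 \<in> polys_in V"
  by (simp add: polys_in_def)

lemma polys_in_pconst [simp]: "pconst a \<in> polys_in V"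
  by (auto simp: polys_in_def pconst_def)

lemma polys_in_one [simp]: "1 \<in> polys_in V"
  using polys_in_pconst[of 1 V] by simp

lemma polys_in_pv: "v \<in> V \<Longrightarrow> pv v \<in> polys_in V"
  by (auto simp: polys_in_def pv_def)

lemma polys_in_add: "f \<in> polys_in V \<Longrightarrow> g \<in> polys_in V \<Longrightarrow> f + g \<in> polys_in V"
  using Poly_Mapping.keys_add[of f g] unfolding polys_in_def by blast

lemma polys_in_uminus: "f \<in> polys_in V \<Longrightarrow> - f \<in> polys_in V"
  by (auto simp: polys_in_def)

lemma polys_in_diff: "f \<in> polys_in V \<Longrightarrow> g \<in> polys_in V \<Longrightarrow> f - g \<in> polys_in V"
  using polys_in_add[OF _ polys_in_uminus, of f V g] by simp

lemma polys_in_mult: "f \<in> polys_in V \<Longrightarrow> g \<in> polys_in V \<Longrightarrow> f * g \<in> polys_in V"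
proof -
  assume fg: "f \<in> polys_in V" "g \<in> polys_in V"
  have "Poly_Mapping.keys m \<subseteq> V" if "m \<in> Poly_Mapping.keys (f * g)" for m
  proof -
    obtain a b where "m = a + b" "a \<in> Poly_Mapping.keys f" "b \<in> Poly_Mapping.keys g"
      using \<open>m \<in> _\<close> keys_mult[of f g] by auto
    then show ?thesis
      using fg Poly_Mapping.keys_add[of a b] unfolding polys_in_def by blast
  qed
  then show ?thesis by (simp add: polys_in_def)
qed

lemma polys_in_sum: "(\<And>i. i \<in> A \<Longrightarrow> f i \<in> polys_in V) \<Longrightarrow> sum f A \<in> polys_in V"
  by (induction A rule: infinite_finite_induct) (auto simp: polys_in_add)

lemma polys_in_prod: "(\<And>i. i \<in> A \<Longrightarrow> f i \<in> polys_in V) \<Longrightarrow> prod f A \<in> polys_in V"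
  by (induction A rule: infinite_finite_induct) (auto simp: polys_in_mult)

lemma polys_in_power: "f \<in> polys_in V \<Longrightarrow> f ^ k \<in> polys_in V"
  by (induction k) (auto simp: polys_in_mult)

lemma polys_in_rename: "f \<in> polys_in V \<Longrightarrow> rename r f \<in> polys_in (r ` V)"
  unfolding rename_def
  by (intro polys_in_sum polys_in_mult polys_in_prod polys_in_power polys_in_pconst polys_in_pv)
    (auto simp: polys_in_def)

definition permute_gam :: "nat \<Rightarrow> (nat \<Rightarrow> nat) \<Rightarrow> pvar \<Rightarrow> pvar" where
  "permute_gam a \<pi> v = (case v of Gam b j \<Rightarrow> if b = a then Gam a (\<pi> j) else Gam b j | _ \<Rightarrow> v)"

definition lam_vars :: "nat \<Rightarrow> nat \<Rightarrow> (nat \<Rightarrow> nat) \<Rightarrow> pvar set" where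
  "lam_vars N n lam = {Gam a j | a j. a \<in> {1..N} \<and> j \<in> {1..lam a}} \<union> base_vars n"

lemma sym_polys_altdef:
  "sym_polys N n lam = {f \<in> polys_in (lam_vars N n lam).
     \<forall>a\<in>{1..N}. \<forall>\<pi>. \<pi> permutes {1..lam a} \<longrightarrow> rename (permute_gam a \<pi>) f = f}"
  by (simp add: sym_polys_def lam_vars_def permute_gam_def[abs_def])

lemma base_in_sym_polys: "f \<in> polys_in (base_vars n) \<Longrightarrow> f \<in> sym_polys N n lam"
proof -
  assume f: "f \<in> polys_in (base_vars n)"
  have "permute_gam a \<pi> v = v" if "v \<in> base_vars n" for a \<pi> v
    using that by (auto simp: base_vars_def permute_gam_def)
  then have "mon_eval (\<lambda>v. pv (permute_gam a \<pi> v)) m = mon_eval pv m"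
    if "m \<in> Poly_Mapping.keys f" for a \<pi> m
    using f that unfolding mon_eval_def polys_in_def
    by (intro prod.cong) (auto dest!: bspec subsetD)
  then have "rename (permute_gam a \<pi>) f = rename id f" for a \<pi>
    unfolding rename_eq_eval mpol_eval_def by (intro sum.cong) auto
  moreover have "rename id f = f"
    by (induction f rule: mpol_induct) (simp_all add: rename_add rename_mult)
  ultimately show ?thesis
    using f polys_in_mono[of "base_vars n" "lam_vars N n lam" f]
    by (auto simp: sym_polys_altdef lam_vars_def)
qed

lemma all_coeffs_mult:
  fixes p q :: "mpol poly"
  shows "(\<And>k. Polynomial.coeff p k \<in> polys_in V) \<Longrightarrow> (\<And>k. Polynomial.coeff q k \<in> polys_in V) \<Longrightarrow> Polynomial.coeff (p * q) k \<in> polys_in V"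
  by (auto simp: coeff_mult intro: polys_in_sum polys_in_mult)

lemma all_coeffs_prod:
  fixes p :: "'i \<Rightarrow> mpol poly"
  shows "(\<And>i k. i \<in> A \<Longrightarrow> Polynomial.coeff (p i) k \<in> polys_in V) \<Longrightarrow> Polynomial.coeff (prod p A) k \<in> polys_in V"
proof (induction A arbitrary: k rule: infinite_finite_induct)
  case (insert x F)
  then show ?case by (auto intro: all_coeffs_mult)
qed (auto simp: coeff_1)

lemma coeff_linear_polys_in: "v \<in> V \<Longrightarrow> Polynomial.coeff [:- pv v, 1:] k \<in> polys_in V"
  by (auto simp: coeff_pCons polys_in_pv polys_in_uminus split: nat.splits)

text \<open>The point is the removal of \<open>Hv\<close> from the variables: this is what makes
  division by \<open>h\<close> compatible with the ideal.\<close>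

lemma coeff_coh_rel_polys_in:
  "Polynomial.coeff (coh_rel N n lam) k \<in> polys_in (lam_vars N n lam - {Hv})"
  unfolding coh_rel_def coeff_diff
  by (intro polys_in_diff all_coeffs_prod coeff_linear_polys_in)
    (auto simp: lam_vars_def base_vars_def)

lemma map_poly_rename_prod:
  "map_poly (rename r) (prod p A) = (\<Prod>i\<in>A. map_poly (rename r) (p i))"
  by (induction A rule: infinite_finite_induct) (simp_all add: map_poly_rename_mult map_poly_1')

text \<open>A permutation inside one group of Chern roots merely reorders a product. This puts the
  relations into the ring of symmetric polynomials, in which the ideal is generated.\<close>

lemma map_poly_rename_coh_rel:
  assumes "\<pi> permutes {1..lam a}"
  shows "map_poly (rename (permute_gam a \<pi>)) (coh_rel N n lam) = coh_rel N n lam"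
proof -
  let ?r = "permute_gam a \<pi>"
  have lin: "map_poly (rename ?r) [:- pv v, 1:] = [:- pv (?r v), 1:]" for v
    by (simp add: map_poly_pCons rename_uminus)
  have g: "(\<Prod>j=1..lam b. [:- pv (?r (Gam b j)), 1:]) = (\<Prod>j=1..lam b. [:- pv (Gam b j), 1:])" for b
    using prod.permute[OF assms, of "\<lambda>j. [:- pv (Gam a j), 1:]"]
    by (cases "b = a") (simp_all add: permute_gam_def o_def)
  have diff: "map_poly (rename ?r) (p - q) = map_poly (rename ?r) p - map_poly (rename ?r) q" for p q
    by (rule poly_eqI) (simp add: coeff_map_poly rename_diff)
  show ?thesis
    unfolding coh_rel_def diff map_poly_rename_prod lin g by (simp add: permute_gam_def)
qed

lemma coeff_coh_rel_in_sym_polys: "Polynomial.coeff (coh_rel N n lam) k \<in> sym_polys N n lam"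
proof -
  have "rename (permute_gam a \<pi>) (Polynomial.coeff (coh_rel N n lam) k) = Polynomial.coeff (coh_rel N n lam) k"
    if "\<pi> permutes {1..lam a}" for a \<pi>
    using map_poly_rename_coh_rel[where a = a and lam = lam and N = N and n = n, OF that] coeff_map_poly[of "rename (permute_gam a \<pi>)"]
    by (metis rename_zero)
  then show ?thesis
    using polys_in_mono[OF _ coeff_coh_rel_polys_in[of N n lam k], of "lam_vars N n lam"]
    by (auto simp: sym_polys_altdef)
qed

interpretation coh: genideal_quotient "sym_polys N n lam" "range (Polynomial.coeff (coh_rel N n lam))"
  rewrites "genideal_quotient.I (sym_polys N n lam) (range (Polynomial.coeff (coh_rel N n lam))) = coh_ideal N n lam"
    and "genideal_quotient.Q (sym_polys N n lam) (range (Polynomial.coeff (coh_rel N n lam))) = HT N n lam"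
    and "genideal_quotient.cls (sym_polys N n lam) (range (Polynomial.coeff (coh_rel N n lam))) = hcls N n lam"
  for N n lam
proof -
  show *: "genideal_quotient (sym_polys N n lam) (range (Polynomial.coeff (coh_rel N n lam)))"
  proof
    show "range (Polynomial.coeff (coh_rel N n lam)) \<subseteq> sym_polys N n lam"
      by (rule image_subsetI) (rule coeff_coh_rel_in_sym_polys)
    show "1 \<in> sym_polys N n lam"
      by (simp add: sym_polys_altdef)
  qed (simp_all add: sym_polys_altdef polys_in_diff polys_in_mult rename_diff rename_mult)
  show I: "genideal_quotient.I (sym_polys N n lam) (range (Polynomial.coeff (coh_rel N n lam))) = coh_ideal N n lam"
    by (simp only: genideal_quotient.I_def[OF *] coh_ideal_def)
  show "genideal_quotient.Q (sym_polys N n lam) (range (Polynomial.coeff (coh_rel N n lam))) = HT N n lam"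
    by (simp only: genideal_quotient.Q_def[OF *] HT_def I)
  show "genideal_quotient.cls (sym_polys N n lam) (range (Polynomial.coeff (coh_rel N n lam))) = hcls N n lam"
    by (rule ext) (simp only: genideal_quotient.cls_def[OF *] hcls_def I)
qed

lemma pconst_sym [simp]: "pconst a \<in> sym_polys N n lam"
  by (rule base_in_sym_polys) simp

lemma Hv_base: "pv Hv \<in> polys_in (base_vars n)"
  by (rule polys_in_pv) (simp add: base_vars_def)

lemma Hv_sym [simp]: "pv Hv \<in> sym_polys N n lam"
  by (rule base_in_sym_polys[OF Hv_base])

lemma D_sym:
  assumes "a \<in> {1..N}"
  shows "(\<Sum>j=1..lam a. pv (Gam a j)) \<in> sym_polys N n lam"
proof -
  have "(\<Sum>j=1..lam a. pv (permute_gam b \<pi> (Gam a j))) = (\<Sum>j=1..lam a. pv (Gam a j))"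
    if "\<pi> permutes {1..lam b}" for b \<pi>
    using sum.permute[OF that, of "\<lambda>j. pv (Gam b j)"]
    by (cases "b = a") (simp_all add: permute_gam_def o_def)
  then show ?thesis
    using assms by (auto simp: sym_polys_altdef rename_sum lam_vars_def intro!: polys_in_sum polys_in_pv)
qed

subsection \<open>Torsion\<close>

text \<open>The quotient of \<open>f\<close> by \<open>h\<close>, discarding the part of \<open>f\<close> free of \<open>h\<close>.\<close>

definition hdiv :: "mpol \<Rightarrow> mpol" where
  "hdiv f = Poly_Mapping.map_key (\<lambda>m. m + Poly_Mapping.single Hv 1) f"

lemma inj_add_Hv: "inj (\<lambda>m. m + Poly_Mapping.single Hv (1::nat))"
  by (rule injI) (rule add_right_imp_eq)

lemma lookup_hdiv: "Poly_Mapping.lookup (hdiv f) m = Poly_Mapping.lookup f (m + Poly_Mapping.single Hv 1)"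
  unfolding hdiv_def Poly_Mapping.map_key.rep_eq[OF inj_add_Hv] by (rule o_apply)

lemma hdiv_zero [simp]: "hdiv 0 = 0"
  by (rule poly_mapping_eqI) (simp add: lookup_hdiv)

lemma hdiv_add: "hdiv (f + g) = hdiv f + hdiv g"
  by (rule poly_mapping_eqI) (simp add: lookup_hdiv Poly_Mapping.lookup_add)

lemma hdiv_Hv_mult: "hdiv (pv Hv * f) = f"
proof (induction f rule: poly_mapping_induct)
  case (single k v)
  show ?case
    using Poly_Mapping.map_key_single[OF inj_add_Hv, of k v]
    by (simp add: hdiv_def pv_def mult_single add.commute)
qed (simp_all add: hdiv_add distrib_left)

lemma hdiv_polys_in: "f \<in> polys_in V \<Longrightarrow> hdiv f \<in> polys_in V"
proof -
  assume f: "f \<in> polys_in V"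
  have "Poly_Mapping.keys m \<subseteq> V" if "m \<in> Poly_Mapping.keys (hdiv f)" for m
  proof -
    have "m + Poly_Mapping.single Hv 1 \<in> Poly_Mapping.keys f"
      using that by (simp add: in_keys_iff lookup_hdiv)
    then have "Poly_Mapping.keys (m + Poly_Mapping.single Hv 1) \<subseteq> V"
      using f by (auto simp: polys_in_def)
    then show ?thesis
      by (auto simp: in_keys_iff Poly_Mapping.lookup_add subset_iff)
  qed
  then show ?thesis by (simp add: polys_in_def)
qed

lemma hdiv_Hv_free: "f \<in> polys_in (- {Hv}) \<Longrightarrow> hdiv f = 0"
proof (rule poly_mapping_eqI)
  fix m :: "pvar \<Rightarrow>\<^sub>0 nat"
  assume f: "f \<in> polys_in (- {Hv})"
  have "Hv \<in> Poly_Mapping.keys (m + Poly_Mapping.single Hv 1)"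
    by (simp add: in_keys_iff Poly_Mapping.lookup_add)
  then have "m + Poly_Mapping.single Hv 1 \<notin> Poly_Mapping.keys f"
    using f by (auto simp: polys_in_def)
  then show "Poly_Mapping.lookup (hdiv f) m = Poly_Mapping.lookup 0 m"
    by (simp add: lookup_hdiv in_keys_iff)
qed

lemma lookup_Hv_mult_hdiv:
  "Poly_Mapping.lookup (pv Hv * hdiv f) m = (if Hv \<in> Poly_Mapping.keys m then Poly_Mapping.lookup f m else 0)"
proof (induction f rule: poly_mapping_induct)
  case (single k v)
  show ?case
  proof (cases "Hv \<in> Poly_Mapping.keys k")
    case True
    have "k = (k - Poly_Mapping.single Hv 1) + Poly_Mapping.single Hv 1"
      using True by (intro poly_mapping_eqI)
        (auto simp: Poly_Mapping.lookup_add Poly_Mapping.lookup_minus lookup_single when_def in_keys_iff)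
    then obtain k' where k: "k = k' + Poly_Mapping.single Hv 1"
      by blast
    have "pv Hv * hdiv (Poly_Mapping.single k v) = Poly_Mapping.single k v"
      using Poly_Mapping.map_key_single[OF inj_add_Hv, of k' v]
      by (simp add: hdiv_def pv_def k mult_single add.commute)
    then show ?thesis
      using True by (auto simp: lookup_single when_def)
  next
    case False
    then have "Poly_Mapping.single k v \<in> polys_in (- {Hv})"
      by (auto simp: polys_in_def)
    then show ?thesis
      using False by (auto simp: hdiv_Hv_free lookup_single when_def)
  qed
qed (auto simp: hdiv_add distrib_left Poly_Mapping.lookup_add)

lemma minus_hdiv_Hv_free: "f - pv Hv * hdiv f \<in> polys_in (- {Hv})"
  by (auto simp: polys_in_def in_keys_iff Poly_Mapping.lookup_minus lookup_Hv_mult_hdiv split: if_splits)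

text \<open>The splitting of \<open>f\<close> into a part free of \<open>h\<close> and a multiple of
  \<open>h\<close> is unique, so exhibiting one such splitting computes \<open>hdiv\<close>.\<close>

lemma hdiv_eqI: "f - pv Hv * g \<in> polys_in (- {Hv}) \<Longrightarrow> hdiv f = g"
  using hdiv_add[of "f - pv Hv * g" "pv Hv * g"] by (simp add: hdiv_Hv_free hdiv_Hv_mult)

text \<open>A twisted product rule: with \<open>f0\<close>, \<open>g0\<close> the parts free of
  \<open>h\<close>, the product \<open>f0 * g0\<close> is again free of \<open>h\<close>, and the
  remaining terms of \<open>f * g\<close> carry a factor \<open>h\<close>.\<close>

lemma hdiv_mult: "hdiv (f * g) = hdiv f * g + (f - pv Hv * hdiv f) * hdiv g"
proof (rule hdiv_eqI)
  have "f * g - pv Hv * (hdiv f * g + (f - pv Hv * hdiv f) * hdiv g)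
      = (f - pv Hv * hdiv f) * (g - pv Hv * hdiv g)"
    by (simp add: algebra_simps)
  then show "f * g - pv Hv * (hdiv f * g + (f - pv Hv * hdiv f) * hdiv g) \<in> polys_in (- {Hv})"
    by (simp add: polys_in_mult minus_hdiv_Hv_free)
qed

text \<open>The assumptions say that the renaming respects both halves of the splitting.\<close>

lemma hdiv_rename:
  assumes "r Hv = Hv" "\<And>v. v \<noteq> Hv \<Longrightarrow> r v \<noteq> Hv"
  shows "hdiv (rename r f) = rename r (hdiv f)"
proof (rule hdiv_eqI)
  have "rename r f - pv Hv * rename r (hdiv f) = rename r (f - pv Hv * hdiv f)"
    by (simp add: rename_diff rename_mult assms(1))
  also have "\<dots> \<in> polys_in (r ` (- {Hv}))"
    by (intro polys_in_rename minus_hdiv_Hv_free)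
  finally have "rename r f - pv Hv * rename r (hdiv f) \<in> polys_in (r ` (- {Hv}))" .
  moreover have "r ` (- {Hv}) \<subseteq> - {Hv}"
  proof (rule image_subsetI)
    fix v assume "v \<in> - {Hv}"
    then have "r v \<noteq> Hv"
      by (intro assms(2)) simp
    then show "r v \<in> - {Hv}"
      by simp
  qed
  ultimately show "rename r f - pv Hv * rename r (hdiv f) \<in> polys_in (- {Hv})"
    by (rule polys_in_mono[rotated])
qed

lemma hdiv_sym: "f \<in> sym_polys N n lam \<Longrightarrow> hdiv f \<in> sym_polys N n lam"
proof -
  have *: "hdiv (rename (permute_gam a \<pi>) f) = rename (permute_gam a \<pi>) (hdiv f)" for a \<pi>
    by (rule hdiv_rename) (auto simp: permute_gam_def split: pvar.splits)
  show "f \<in> sym_polys N n lam \<Longrightarrow> hdiv f \<in> sym_polys N n lam"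
    by (auto simp: sym_polys_altdef hdiv_polys_in simp flip: *)
qed

text \<open>The relations do not involve \<open>h\<close>, so \<open>hdiv\<close> preserves the ideal they generate.\<close>

lemma coh_torsion_free:
  assumes "pv Hv * f \<in> coh_ideal N n lam"
  shows "f \<in> coh_ideal N n lam"
proof -
  \<comment> \<open>Membership of \<open>f\<close> itself is carried along because
    \<open>hdiv (y * f)\<close> involves \<open>hdiv y * f\<close> besides a multiple of
    \<open>hdiv f\<close>.\<close>
  let ?J = "{f \<in> coh_ideal N n lam. hdiv f \<in> coh_ideal N n lam}"
  have "coh_ideal N n lam \<subseteq> ?J"
  proof (rule coh.I_minimal)
    have "hdiv (Polynomial.coeff (coh_rel N n lam) k) = 0" for k
      by (rule hdiv_Hv_free, rule polys_in_mono[OF _ coeff_coh_rel_polys_in]) auto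
    then show "range (Polynomial.coeff (coh_rel N n lam)) \<subseteq> ?J"
      using coh.gens_subset_I[of N n lam] by (auto simp: coh.zero_mem_I)
    show *: "y * x \<in> ?J" if "x \<in> ?J" "y \<in> sym_polys N n lam" for x y
      using that by (auto simp: hdiv_mult intro!: coh.mult_left_mem_I coh.add_mem_I hdiv_sym
          coh.diff_mem coh.mult_mem)
    show "x * y \<in> ?J" if "x \<in> ?J" "y \<in> sym_polys N n lam" for x y
      using *[OF that] by (simp add: mult.commute)
  qed (use coh.I_subset in \<open>auto simp: hdiv_add coh.zero_mem_I coh.add_mem_I\<close>)
  then have "hdiv (pv Hv * f) \<in> coh_ideal N n lam"
    using assms by auto
  then show ?thesis
    by (simp add: hdiv_Hv_mult)
qed

subsection \<open>Coefficients of the formulas for the action\<close>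

lemma fps_mult_nth_2:
  "(f * g :: 'a::semiring_0 fps) $ 2 = f $ 0 * g $ 2 + f $ 1 * g $ 1 + f $ 2 * g $ 0"
  by (simp add: fps_mult_nth numeral_2_eq_2)

lemma inv_u_minus_nth [simp]:
  "inv_u_minus c $ 0 = 0" "inv_u_minus c $ 1 = 1" "inv_u_minus c $ Suc 0 = 1" "inv_u_minus c $ 2 = c"
  by (simp_all add: inv_u_minus_def)

text \<open>At order two either one factor contributes its second coefficient, or two distinct
  factors contribute \<open>c\<close> each.\<close>

lemma prod_nth_012:
  fixes F :: "'i \<Rightarrow> 'a::comm_ring_1 fps"
  assumes "finite A" "\<And>i. i \<in> A \<Longrightarrow> F i $ 0 = 1" "\<And>i. i \<in> A \<Longrightarrow> F i $ 1 = c"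
  shows "prod F A $ 0 = 1 \<and> prod F A $ 1 = of_nat (card A) * c \<and>
    prod F A $ 2 = (\<Sum>i\<in>A. F i $ 2) + of_nat (card A choose 2) * c\<^sup>2"
  using assms
proof (induction A rule: finite_induct)
  case (insert a A)
  have "Suc k choose 2 = k + (k choose 2)" for k
    by (simp add: numeral_2_eq_2)
  then show ?case
    using insert by (simp add: fps_mult_nth_2 fps_mult_nth_1 algebra_simps power2_eq_square)
qed (simp add: numeral_2_eq_2)

text \<open>Each factor expands as \<open>1 - h u^-1 - h gamma u^-2 - ...\<close>, and there are
  \<open>L\<close> of them with the same linear coefficient.\<close>

lemma A_fun_nth:
  fixes lam p
  defines "L \<equiv> \<Sum>a=1..p. lam a"
  shows "A_fun lam p f $ 1 = - (of_nat L * pv Hv) * f"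
    and "A_fun lam p f $ 2 =
      (of_nat (L choose 2) * (pv Hv)\<^sup>2 - pv Hv * (\<Sum>a=1..p. \<Sum>i=1..lam a. pv (Gam a i))) * f"
proof -
  let ?F = "\<lambda>(a, i). 1 - fps_const (pv Hv) * inv_u_minus (pv (Gam a i)) :: mpol fps"
  let ?S = "SIGMA a:{1..p}. {1..lam a}"
  have P: "(\<Prod>a=1..p. \<Prod>i=1..lam a. 1 - fps_const (pv Hv) * inv_u_minus (pv (Gam a i))) = prod ?F ?S"
    by (subst prod.Sigma) auto
  have nth: "prod ?F ?S $ 0 = 1 \<and> prod ?F ?S $ 1 = of_nat (card ?S) * (- pv Hv) \<and>
      prod ?F ?S $ 2 = (\<Sum>i\<in>?S. ?F i $ 2) + of_nat (card ?S choose 2) * (- pv Hv)\<^sup>2"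
    by (rule prod_nth_012) auto
  have card: "card ?S = L"
    by (simp add: L_def)
  have sum: "(\<Sum>i\<in>?S. ?F i $ 2) = - (pv Hv * (\<Sum>a=1..p. \<Sum>i=1..lam a. pv (Gam a i)))"
  proof -
    have "(\<Sum>i\<in>?S. ?F i $ 2) = (\<Sum>(a, i)\<in>?S. - (pv Hv * pv (Gam a i)))"
      by (intro sum.cong) (auto simp: fps_mult_nth_2)
    also have "\<dots> = (\<Sum>a=1..p. \<Sum>i=1..lam a. - (pv Hv * pv (Gam a i)))"
      by (rule sum.Sigma[symmetric]) auto
    finally show ?thesis
      by (simp add: sum_negf sum_distrib_left)
  qed
  have A: "A_fun lam p f $ m = f * prod ?F ?S $ m" for m
    unfolding A_fun_def P by (rule fps_mult_left_const_nth)
  show "A_fun lam p f $ 1 = - (of_nat L * pv Hv) * f"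
    unfolding A conjunct1[OF conjunct2[OF nth]] card by simp
  show "A_fun lam p f $ 2 =
      (of_nat (L choose 2) * (pv Hv)\<^sup>2 - pv Hv * (\<Sum>a=1..p. \<Sum>i=1..lam a. pv (Gam a i))) * f"
    unfolding A conjunct2[OF conjunct2[OF nth]] card sum by simp
qed

lemma tdeg_le_pv_diff3: "tdeg_le (pv u - pv v - pv w) 1"
  by (intro tdeg_le_diff tdeg_le_pv)

text \<open>The coefficient of \<open>u^-1\<close> in \<open>1 / (u - gamma)\<close> is
  \<open>1\<close>. Each summand is then \<open>f\<close> renamed, over \<open>lam p - 1\<close>
  linear denominators, times \<open>lam (Suc p)\<close> linear factors; \<open>lam\<close> is the
  index of the target.\<close>

lemma E_fun_tdeg:
  assumes "tdeg_le f d"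
  shows "frac_tdeg_le (E_fun lam p f $ 1) (d - int (lam p) + 1 + int (lam (Suc p)))"
proof -
  have "frac_tdeg_le (to_frac (rename (move_var lam p i (Suc p)) f) *
           (\<Prod>j\<in>{1..lam p} - {i}. 1 / to_frac (pv (Gam p j) - pv (Gam p i))) *
           (\<Prod>k=1..lam (Suc p). to_frac (pv (Gam p i) - pv (Gam (Suc p) k) - pv Hv)))
         (d + int (card ({1..lam p} - {i})) * (- 1) + int (card {1..lam (Suc p)}) * 1)" for i
    by (intro frac_tdeg_le_mult frac_tdeg_le_prod frac_tdeg_le_to_frac frac_tdeg_le_inverse_pv_diff
        tdeg_le_rename assms tdeg_le_pv_diff3) auto
  moreover have "d + int (card ({1..lam p} - {i})) * (- 1) + int (card {1..lam (Suc p)}) * 1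
      = d - int (lam p) + 1 + int (lam (Suc p))" if "i \<in> {1..lam p}" for i
    using that by (auto simp: of_nat_diff)
  ultimately show ?thesis
    unfolding E_fun_def fps_sum_nth fps_mult_left_const_nth inv_u_minus_nth mult_1_right
    by (intro frac_tdeg_le_sum) metis
qed

lemma F_fun_tdeg:
  assumes "tdeg_le f d"
  shows "frac_tdeg_le (F_fun lam p f $ 1) (d - int (lam (Suc p)) + 1 + int (lam p))"
proof -
  have "frac_tdeg_le (to_frac (rename (move_var lam (Suc p) i p) f) *
           (\<Prod>j\<in>{1..lam (Suc p)} - {i}. 1 / to_frac (pv (Gam (Suc p) i) - pv (Gam (Suc p) j))) *
           (\<Prod>k=1..lam p. to_frac (pv (Gam p k) - pv (Gam (Suc p) i) - pv Hv)))
         (d + int (card ({1..lam (Suc p)} - {i})) * (- 1) + int (card {1..lam p}) * 1)" for i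
    by (intro frac_tdeg_le_mult frac_tdeg_le_prod frac_tdeg_le_to_frac frac_tdeg_le_inverse_pv_diff
        tdeg_le_rename assms tdeg_le_pv_diff3) auto
  moreover have "d + int (card ({1..lam (Suc p)} - {i})) * (- 1) + int (card {1..lam p}) * 1
      = d - int (lam (Suc p)) + 1 + int (lam p)" if "i \<in> {1..lam (Suc p)}" for i
    using that by (auto simp: of_nat_diff)
  ultimately show ?thesis
    unfolding F_fun_def fps_sum_nth fps_mult_left_const_nth inv_u_minus_nth mult_1_right
    by (intro frac_tdeg_le_sum) metis
qed

section \<open>The Yangian\<close>

lemma yconst_one [simp]: "yconst 1 = 1"
  by (simp add: yconst_def)

lemma yconst_commute: "x * yconst p = yconst p * x"
  by (induction x rule: poly_mapping_induct)
    (simp_all add: yconst_def mult_single algebra_simps)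

lemma hY_commute: "x * hY = hY * x"
  by (simp add: hY_def yconst_commute)

lemma lookup_yconst_mult: "Poly_Mapping.lookup (yconst p * x) w = p * Poly_Mapping.lookup x w"
  by (induction x rule: poly_mapping_induct)
    (simp_all add: yconst_def mult_single lookup_single when_def algebra_simps Poly_Mapping.lookup_add)

text \<open>The content is uniqueness in the definite description: multiplication by
  \<open>h\<close> acts on each coefficient, in the domain \<open>complex poly\<close>.\<close>

lemma div_h_hY_mult: "div_h (hY * x) = x"
  unfolding div_h_def
proof (rule the_equality)
  fix y assume "hY * y = hY * x"
  then have "Poly_Mapping.lookup (yconst [:0, 1:] * y) w = Poly_Mapping.lookup (yconst [:0, 1:] * x) w" for w
    by (simp add: hY_def)
  then show "y = x"
    by (intro poly_mapping_eqI) (simp add: lookup_yconst_mult)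
qed simp

subsection \<open>Low-order coefficients of quantum minors\<close>

text \<open>The substituted series is \<open>- h / (u + k h) = - h u^-1 + k h^2 u^-2 - ...\<close>,
  so the shift \<open>k\<close> brings the first generator into the second coefficient.\<close>

lemma Tser_nth:
  "Tser i j k $ 0 = (if i = j then 1 else 0)"
  "Tser i j k $ 1 = - (hY * tcoef i j 1)"
  "Tser i j k $ 2 = hY * hY * (of_nat k * tcoef i j 1 + tcoef i j 2)"
proof -
  let ?X = "fps_const (- hY) * inv_u_minus (- (of_nat k * hY)) :: free_alg fps"
  have X: "?X $ 0 = 0" "?X $ 1 = - hY" "?X $ 2 = hY * (of_nat k * hY)"
    by (simp_all add: inv_u_minus_def)
  have t0: "tcoef i j 0 = (if i = j then 1 else 0)"
    by (simp add: tcoef_def)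
  show "Tser i j k $ 0 = (if i = j then 1 else 0)"
    by (simp add: Tser_def t0)
  have "Tser i j k $ 1 = tcoef i j 0 * (?X ^ 0) $ 1 + tcoef i j 1 * (?X ^ 1) $ 1"
    by (simp add: Tser_def)
  then show "Tser i j k $ 1 = - (hY * tcoef i j 1)"
    unfolding power_one_right X by (simp add: hY_commute)
  have "Tser i j k $ 2 = tcoef i j 0 * (?X ^ 0) $ 2 + tcoef i j 1 * (?X ^ 1) $ 2 + tcoef i j 2 * (?X * ?X) $ 2"
    by (simp add: Tser_def numeral_2_eq_2)
  also have "\<dots> = tcoef i j 1 * (hY * (of_nat k * hY)) + tcoef i j 2 * (hY * hY)"
    unfolding fps_mult_nth_2[of ?X ?X] power_one_right X by simp
  also have "\<dots> = hY * hY * (of_nat k * tcoef i j 1 + tcoef i j 2)"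
    by (metis (no_types, opaque_lifting) distrib_left hY_commute mult.assoc mult_of_nat_commute)
  finally show "Tser i j k $ 2 = hY * hY * (of_nat k * tcoef i j 1 + tcoef i j 2)" .
qed

text \<open>Every factor without constant term is divisible by the central series variable. This
  limits which permutations contribute to a low-order coefficient of a quantum minor.\<close>

lemma prod_list_nth_eq_0:
  fixes F :: "'i \<Rightarrow> 'a::ring_1 fps"
  assumes "m < length (filter (\<lambda>k. F k $ 0 = 0) xs)"
  shows "prod_list (map F xs) $ m = 0"
  using assms
proof (induction xs arbitrary: m)
  case (Cons x xs)
  have "F x $ i * prod_list (map F xs) $ (m - i) = 0" if "i \<le> m" for i
    using Cons.prems Cons.IH[of "m - i"] that by (cases "i = 0") (auto split: if_splits)
  then show ?case
    by (simp add: fps_mult_nth)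
qed simp

lemma prod_list_upt_nth_eq_0:
  fixes F :: "nat \<Rightarrow> 'a::ring_1 fps"
  assumes "Z \<subseteq> {..<p}" "m < card Z" "\<And>k. k \<in> Z \<Longrightarrow> F k $ 0 = 0"
  shows "prod_list (map F [0..<p]) $ m = 0"
proof (rule prod_list_nth_eq_0)
  have "card Z \<le> card {k \<in> {..<p}. F k $ 0 = 0}"
    using assms by (intro card_mono) auto
  also have "\<dots> = length (filter (\<lambda>k. F k $ 0 = 0) [0..<p])"
    by (subst distinct_card[symmetric]) (auto intro!: arg_cong[of _ _ card])
  finally show "m < length (filter (\<lambda>k. F k $ 0 = 0) [0..<p])"
    using assms by simp
qed

lemma prod_list_nth_0:
  fixes F :: "'i \<Rightarrow> 'a::ring_1 fps"
  shows "(\<And>k. k \<in> set xs \<Longrightarrow> F k $ 0 = 1) \<Longrightarrow> prod_list (map F xs) $ 0 = 1"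
  by (induction xs) auto

text \<open>The coefficients do not commute, so the mixed terms must keep the order
  \<open>k < l\<close> of the factors.\<close>

lemma prod_list_upt_nth_12:
  fixes F :: "nat \<Rightarrow> 'a::ring_1 fps"
  assumes "\<And>k. k < p \<Longrightarrow> F k $ 0 = 1"
  shows "prod_list (map F [0..<p]) $ 1 = (\<Sum>k<p. F k $ 1) \<and>
    prod_list (map F [0..<p]) $ 2 = (\<Sum>l<p. F l $ 2 + (\<Sum>k<l. F k $ 1 * F l $ 1))"
  using assms
proof (induction p)
  case (Suc p)
  have "prod_list (map F [0..<p]) $ 0 = 1"
    using Suc.prems by (intro prod_list_nth_0) auto
  then show ?case
    using Suc by (simp add: fps_mult_nth_1 fps_mult_nth_2 sum_distrib_right add_ac)
qed simp

lemma prod_list_upt_nth_2_two_zeros: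
  fixes F :: "nat \<Rightarrow> 'a::ring_1 fps"
  assumes "k < l" "l < p" "F k $ 0 = 0" "F l $ 0 = 0"
    and "\<And>j. j < p \<Longrightarrow> j \<noteq> k \<Longrightarrow> j \<noteq> l \<Longrightarrow> F j $ 0 = 1"
  shows "prod_list (map F [0..<p]) $ 2 = F k $ 1 * F l $ 1"
proof -
  have "[0..<p] = [0..<k] @ k # [Suc k..<l] @ l # [Suc l..<p]"
    using assms(1,2) upt_add_eq_append[of 0 k "p - k"] upt_add_eq_append[of "Suc k" l "p - l"]
    by (simp add: upt_conv_Cons)
  moreover have "prod_list (map F [0..<k]) $ 0 = 1" "prod_list (map F [Suc k..<l]) $ 0 = 1"
    "prod_list (map F [Suc l..<p]) $ 0 = 1"
    using assms by (auto intro!: prod_list_nth_0)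
  ultimately show ?thesis
    using assms(3,4) by (simp add: fps_mult_nth_2 fps_mult_nth_1)
qed

lemma permutes_two_moved:
  assumes "\<sigma> permutes S" "\<sigma> \<noteq> id"
  obtains k l where "k \<in> S" "l \<in> S" "k \<noteq> l" "\<sigma> k = l" "\<sigma> l \<noteq> l"
proof -
  obtain k where k: "\<sigma> k \<noteq> k"
    using assms(2) by (auto simp: fun_eq_iff)
  then have "k \<in> S" "\<sigma> k \<in> S"
    using assms(1) permutes_not_in permutes_in_image by metis+
  moreover have "\<sigma> (\<sigma> k) \<noteq> \<sigma> k"
    using k permutes_inj[OF assms(1)] by (auto dest: injD)
  ultimately show ?thesis
    using k that by metis
qed

text \<open>If nothing besides \<open>k\<close> and \<open>l = \<sigma> k\<close> moved, injectivity
  would force \<open>\<sigma> l = k\<close>, a transposition. Three displaced indices give three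
  factors without constant term, too many for order two.\<close>

lemma permutes_three_moved:
  assumes "\<sigma> permutes S" "finite S" "\<sigma> \<noteq> id" "\<And>k l. \<sigma> \<noteq> Transposition.transpose k l"
  shows "card {k \<in> S. \<sigma> k \<noteq> k} \<ge> 3"
proof -
  obtain k l where kl: "k \<in> S" "l \<in> S" "k \<noteq> l" "\<sigma> k = l" "\<sigma> l \<noteq> l"
    by (rule permutes_two_moved[OF assms(1,3)])
  have "\<exists>m. m \<noteq> k \<and> m \<noteq> l \<and> \<sigma> m \<noteq> m"
  proof (rule ccontr)
    assume fixed: "\<not> ?thesis"
    have "\<sigma> l = k"
    proof (rule ccontr)
      assume "\<sigma> l \<noteq> k"
      then have "\<sigma> (\<sigma> l) = \<sigma> l"
        using fixed kl by auto
      then show False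
        using permutes_inj[OF assms(1)] kl(5) by (auto dest: injD)
    qed
    then have "\<sigma> = Transposition.transpose k l"
      using fixed kl by (auto simp: fun_eq_iff Transposition.transpose_def)
    then show False
      using assms(4) by blast
  qed
  then obtain m where m: "m \<noteq> k" "m \<noteq> l" "\<sigma> m \<noteq> m" by blast
  then have "{k, l, m} \<subseteq> {k \<in> S. \<sigma> k \<noteq> k}"
    using kl permutes_not_in[OF assms(1)] by auto
  then have "card {k, l, m} \<le> card {k \<in> S. \<sigma> k \<noteq> k}"
    using assms(2) by (intro card_mono) auto
  then show ?thesis
    using kl m by simp
qed

lemma A_ser_nth_sum:
  "A_ser p $ m = (\<Sum>\<sigma> | \<sigma> permutes {0..<p}. of_int (sign \<sigma>) *
     prod_list (map (\<lambda>k. Tser (Suc k) (Suc (\<sigma> k)) k) [0..<p]) $ m)"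
proof -
  have "(of_int (sign \<sigma>) * prod_list (map (\<lambda>k. Tser ([1..<Suc p] ! k) ([1..<Suc p] ! \<sigma> k) k) [0..<p])) $ m
      = of_int (sign \<sigma>) * prod_list (map (\<lambda>k. Tser (Suc k) (Suc (\<sigma> k)) k) [0..<p]) $ m"
    if "\<sigma> permutes {0..<p}" for \<sigma>
  proof -
    have "\<sigma> k < p" if "k < p" for k
      using permutes_in_image[OF \<open>\<sigma> permutes _\<close>, of k] that by auto
    then have "map (\<lambda>k. Tser ([1..<Suc p] ! k) ([1..<Suc p] ! \<sigma> k) k) [0..<p]
        = map (\<lambda>k. Tser (Suc k) (Suc (\<sigma> k)) k) [0..<p]"
      by (intro map_cong) (auto simp del: upt_Suc)
    moreover have "(of_int (sign \<sigma>) :: free_alg fps) = fps_const (of_int (sign \<sigma>))"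
      by (simp add: fps_of_int)
    ultimately show ?thesis
      by (simp only: fps_mult_left_const_nth)
  qed
  then show ?thesis
    unfolding A_ser_def Mser_def fps_sum_nth by (intro sum.cong) auto
qed

text \<open>A permutation other than \<open>id\<close> displaces at least two indices, and each
  off-diagonal \<open>Tser\<close> starts at order one, so only \<open>id\<close>
  contributes.\<close>

lemma A_ser_nth_1: "A_ser p $ 1 = - (hY * (\<Sum>k=1..p. e_gen k k))"
proof -
  let ?t = "\<lambda>\<sigma>. of_int (sign \<sigma>) * prod_list (map (\<lambda>k. Tser (Suc k) (Suc (\<sigma> k)) k) [0..<p]) $ 1"
  have "?t \<sigma> = 0" if \<sigma>: "\<sigma> permutes {0..<p}" "\<sigma> \<noteq> id" for \<sigma>
  proof -
    obtain k l where "k \<in> {0..<p}" "l \<in> {0..<p}" "k \<noteq> l" "\<sigma> k = l" "\<sigma> l \<noteq> l"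
      by (rule permutes_two_moved[OF \<sigma>])
    then have "prod_list (map (\<lambda>k. Tser (Suc k) (Suc (\<sigma> k)) k) [0..<p]) $ 1 = 0"
      by (intro prod_list_upt_nth_eq_0[of "{k, l}"]) (auto simp: Tser_nth)
    then show ?thesis by simp
  qed
  then have "A_ser p $ 1 = (\<Sum>\<sigma>\<in>{id}. ?t \<sigma>)"
    unfolding A_ser_nth_sum by (intro sum.mono_neutral_right) (auto simp: permutes_id finite_permutations)
  also have "\<dots> = (\<Sum>k<p. Tser (Suc k) (Suc k) k $ 1)"
    using prod_list_upt_nth_12[of p "\<lambda>k. Tser (Suc k) (Suc k) k"] by (simp add: Tser_nth sign_id)
  also have "\<dots> = - (hY * (\<Sum>k<p. e_gen (Suc k) (Suc k)))"
    by (simp add: Tser_nth[unfolded One_nat_def] sum_negf sum_distrib_left e_gen_def)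
  also have "(\<Sum>k<p. e_gen (Suc k) (Suc k)) = (\<Sum>k=1..p. e_gen k k)"
    by (rule sum.reindex_bij_witness[of _ "\<lambda>k. k - 1" Suc]) auto
  finally show ?thesis .
qed

text \<open>The share of index \<open>i\<close> in the coefficient of \<open>u^-2\<close> of
  \<open>A_p\<close>, with one \<open>h\<close> divided out. The multiple \<open>i - 1\<close> of
  \<open>e_{i,i}\<close> is the argument shift of the \<open>i\<close>-th factor; the sum has the
  diagonal products from \<open>id\<close> and, negatively, those from the transpositions
  \<open>(k i)\<close>. The remaining \<open>h\<close> keeps the element in
  \<open>Ytilde\<close>.\<close>

definition Z_el :: "nat \<Rightarrow> free_alg" where
  "Z_el i = hY * (of_nat (i - 1) * e_gen i i + tcoef i i 2
     + (\<Sum>k=1..<i. e_gen k k * e_gen i i - e_gen i k * e_gen k i))"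

lemma hY_hY_mult: "(hY * x) * (hY * y) = hY * (hY * (x * y))"
  by (metis hY_commute mult.assoc)

lemma A_ser_nth_2: "A_ser p $ 2 = hY * (\<Sum>i=1..p. Z_el i)"
proof -
  let ?F = "\<lambda>\<sigma> k. Tser (Suc k) (Suc (\<sigma> k)) k"
  let ?t = "\<lambda>\<sigma>. of_int (sign \<sigma>) * prod_list (map (?F \<sigma>) [0..<p]) $ 2"
  let ?P = "SIGMA l:{..<p}. {..<l}"
  let ?g = "\<lambda>(l, k). Transposition.transpose k l :: nat \<Rightarrow> nat"
  have tr: "?g x permutes {0..<p}" "?g x \<noteq> id" if x: "x \<in> ?P" for x
  proof -
    show "?g x permutes {0..<p}"
      using x by (auto intro!: permutes_swap_id)
    obtain l k where "x = (l, k)" "k < l"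
      using x by (cases x) auto
    then have "?g x k \<noteq> id k"
      by simp
    then show "?g x \<noteq> id" by metis
  qed
  have zero: "?t \<sigma> = 0" if \<sigma>: "\<sigma> permutes {0..<p}" "\<sigma> \<noteq> id" "\<sigma> \<notin> ?g ` ?P" for \<sigma>
  proof -
    have "\<sigma> \<noteq> Transposition.transpose k l" for k l
    proof
      assume \<sigma>': "\<sigma> = Transposition.transpose k l"
      then have "k \<noteq> l" using \<sigma>(2) by auto
      then have "\<sigma> k \<noteq> k" "\<sigma> l \<noteq> l" using \<sigma>' by auto
      then have "k < p" "l < p"
        using permutes_not_in[OF \<sigma>(1)] by (metis atLeastLessThan_iff zero_le)+
      then have "(k, l) \<in> ?P \<or> (l, k) \<in> ?P" using \<open>k \<noteq> l\<close> by auto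
      moreover have "?g (k, l) = \<sigma>" "?g (l, k) = \<sigma>"
        using \<sigma>' by (auto simp: Transposition.transpose_commute)
      ultimately show False using \<sigma>(3) by (metis image_eqI)
    qed
    then have "card {k \<in> {0..<p}. \<sigma> k \<noteq> k} \<ge> 3"
      using permutes_three_moved[OF \<sigma>(1) _ \<sigma>(2)] by auto
    then have "prod_list (map (?F \<sigma>) [0..<p]) $ 2 = 0"
      by (intro prod_list_upt_nth_eq_0[of "{k \<in> {0..<p}. \<sigma> k \<noteq> k}"]) (auto simp: Tser_nth)
    then show ?thesis by simp
  qed
  have inj: "inj_on ?g ?P"
  proof (rule inj_onI)
    fix x y assume xy: "x \<in> ?P" "y \<in> ?P" "?g x = ?g y"
    obtain l k l' k' where *: "x = (l, k)" "y = (l', k')" "k < l" "k' < l'"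
      using xy by (cases x; cases y) auto
    \<comment> \<open>The pair is recovered from its transposition as the set of displaced points,
      together with \<open>k < l\<close>.\<close>
    have "{a. ?g (l, k) a \<noteq> a} = {k, l}" if "k < l" for k l
      using that by (auto simp: Transposition.transpose_def)
    then have "{k, l} = {k', l'}"
      using xy(3) * by metis
    then show "x = y"
      using * by (auto simp: doubleton_eq_iff)
  qed
  have t: "?t (?g x) = - (hY * (hY * (e_gen (Suc l) (Suc k) * e_gen (Suc k) (Suc l))))"
    if "x \<in> ?P" "x = (l, k)" for x l k
  proof -
    have "prod_list (map (?F (?g x)) [0..<p]) $ 2 = ?F (?g x) k $ 1 * ?F (?g x) l $ 1"
      using that by (intro prod_list_upt_nth_2_two_zeros) (auto simp: Tser_nth Transposition.transpose_def)
    then show ?thesis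
      using that by (simp add: Tser_nth[unfolded One_nat_def] sign_swap_id hY_hY_mult e_gen_def)
  qed
  have "A_ser p $ 2 = (\<Sum>\<sigma>\<in>insert id (?g ` ?P). ?t \<sigma>)"
    unfolding A_ser_nth_sum
  proof (rule sum.mono_neutral_right)
    show "insert id (?g ` ?P) \<subseteq> {\<sigma>. \<sigma> permutes {0..<p}}"
      using tr(1) by (auto simp: permutes_id)
  qed (use zero in \<open>auto simp: finite_permutations\<close>)
  also have "\<dots> = ?t id + (\<Sum>\<sigma>\<in>?g ` ?P. ?t \<sigma>)"
  proof (rule sum.insert)
    show "id \<notin> ?g ` ?P"
      using tr(2) by (metis imageE)
  qed auto
  also have "(\<Sum>\<sigma>\<in>?g ` ?P. ?t \<sigma>) = (\<Sum>(l, k)\<in>?P. - (hY * (hY * (e_gen (Suc l) (Suc k) * e_gen (Suc k) (Suc l)))))"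
    unfolding sum.reindex[OF inj] o_def by (rule sum.cong) (use t in auto)
  also have "\<dots> = (\<Sum>l<p. \<Sum>k<l. - (hY * (hY * (e_gen (Suc l) (Suc k) * e_gen (Suc k) (Suc l)))))"
    by (rule sum.Sigma[symmetric]) auto
  also have "?t id = (\<Sum>l<p. ?F id l $ 2 + (\<Sum>k<l. ?F id k $ 1 * ?F id l $ 1))"
    using prod_list_upt_nth_12[of p "?F id"] by (simp add: Tser_nth sign_id)
  also have "\<dots> + (\<Sum>l<p. \<Sum>k<l. - (hY * (hY * (e_gen (Suc l) (Suc k) * e_gen (Suc k) (Suc l)))))
      = (\<Sum>l<p. hY * Z_el (Suc l))"
  proof (subst sum.distrib[symmetric], rule sum.cong[OF refl])
    fix l
    have *: "(\<Sum>k=1..<Suc l. g k) = (\<Sum>k<l. g (Suc k))" for g :: "nat \<Rightarrow> free_alg"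
      by (rule sum.reindex_bij_witness[of _ Suc "\<lambda>k. k - 1"]) auto
    have **: "tcoef a b s * (hY * y) = hY * (tcoef a b s * y)" for a b s y
      by (metis hY_commute mult.assoc)
    show "?F id l $ 2 + (\<Sum>k<l. ?F id k $ 1 * ?F id l $ 1) +
        (\<Sum>k<l. - (hY * (hY * (e_gen (Suc l) (Suc k) * e_gen (Suc k) (Suc l))))) = hY * Z_el (Suc l)"
      unfolding Z_el_def *
      by (simp add: Tser_nth[unfolded One_nat_def] ** hY_hY_mult e_gen_def sum_distrib_left sum_subtractf
          sum_negf algebra_simps)
  qed
  also have "\<dots> = hY * (\<Sum>i=1..p. Z_el i)"
    unfolding sum_distrib_left by (rule sum.reindex_bij_witness[of _ "\<lambda>k. k - 1" Suc]) auto
  finally show ?thesis .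
qed

text \<open>The second-order generator, the products \<open>e_{i,k} e_{k,i}\<close> and the
  \<open>i - 1\<close> copies of \<open>e_{i,i}\<close> hidden in the \<open>G_el\<close> all
  cancel. This holds in the free algebra, before any relation; the right side consists of weight
  operators.\<close>

lemma X_inf_plus_Z_el:
  "X_inf i + Z_el i = yconst [:0, 1/2:] * (e_gen i i * (e_gen i i - 1))
     + hY * (\<Sum>k=1..<i. e_gen k k * e_gen i i)"
proof -
  have cancel: "- hY * t + a + hY * (s - m) + hY * (m + t + (s' - s)) = a + hY * s'" for a t s s' m
    by (simp add: distrib_left right_diff_distrib)
  have "(\<Sum>k=1..<i. G_el i k) = (\<Sum>k=1..<i. e_gen i k * e_gen k i) - of_nat (i - 1) * e_gen i i"
    by (simp add: G_el_def sum_subtractf)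
  then show ?thesis
    unfolding X_inf_def Z_el_def sum_subtractf by (simp only: cancel)
qed

text \<open>Covers rows and columns that agree except in the last place. Under \<open>id\<close>
  exactly the last factor lacks a constant term; any other permutation produces two such
  factors.\<close>

lemma Mser_nth_01:
  assumes p: "p > 0" "length I = p"
    and ne: "\<And>k l. k < p \<Longrightarrow> l < p \<Longrightarrow> k \<noteq> l \<Longrightarrow> I ! k \<noteq> J ! l"
    and last: "I ! (p - 1) \<noteq> J ! (p - 1)"
    and eq: "\<And>k. k < p - 1 \<Longrightarrow> I ! k = J ! k"
  shows "Mser I J $ 0 = 0" "Mser I J $ 1 = - (hY * tcoef (I ! (p - 1)) (J ! (p - 1)) 1)"
proof -
  let ?L = "\<lambda>\<sigma>. prod_list (map (\<lambda>k. Tser (I ! k) (J ! \<sigma> k) k) [0..<p])"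
  have of_int: "(of_int z :: free_alg fps) = fps_const (of_int z)" for z
    by (simp add: fps_of_int)
  have M: "Mser I J $ m = (\<Sum>\<sigma> | \<sigma> permutes {0..<p}. of_int (sign \<sigma>) * ?L \<sigma> $ m)" for m
    by (simp add: Mser_def fps_sum_nth p of_int)
  have z: "?L \<sigma> $ 1 = 0 \<and> ?L \<sigma> $ 0 = 0" if \<sigma>: "\<sigma> permutes {0..<p}" "\<sigma> \<noteq> id" for \<sigma>
  proof -
    obtain k l where kl: "k \<in> {0..<p}" "l \<in> {0..<p}" "k \<noteq> l" "\<sigma> k = l" "\<sigma> l \<noteq> l"
      by (rule permutes_two_moved[OF \<sigma>])
    moreover have "\<sigma> l < p"
      using permutes_in_image[OF \<sigma>(1), of l] kl by auto
    ultimately have "k < p" "l < p" "I ! k \<noteq> J ! \<sigma> k" "I ! l \<noteq> J ! \<sigma> l"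
      using ne by auto
    then show ?thesis
      using kl(3) by (intro conjI prod_list_upt_nth_eq_0[of "{k, l}"]) (auto simp: Tser_nth)
  qed
  have upt: "[0..<p] = [0..<p - 1] @ [p - 1]"
    using p(1) by (metis One_nat_def Suc_pred upt_Suc zero_le)
  have "prod_list (map (\<lambda>k. Tser (I ! k) (J ! k) k) [0..<p - 1]) $ 0 = 1"
    by (rule prod_list_nth_0) (auto simp: Tser_nth eq)
  then have i: "?L id $ 0 = 0" "?L id $ 1 = - (hY * tcoef (I ! (p - 1)) (J ! (p - 1)) 1)"
    unfolding upt using last by (simp_all add: fps_mult_nth_1 Tser_nth[unfolded One_nat_def])
  have "Mser I J $ m = (\<Sum>\<sigma>\<in>{id}. of_int (sign \<sigma>) * ?L \<sigma> $ m)" if "m = 0 \<or> m = 1" for m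
  proof -
    have "of_int (sign \<sigma>) * ?L \<sigma> $ m = 0" if "\<sigma> permutes {0..<p}" "\<sigma> \<noteq> id" for \<sigma>
      using z[OF that] \<open>m = 0 \<or> m = 1\<close> by auto
    then show ?thesis
      unfolding M by (intro sum.mono_neutral_right) (auto simp: permutes_id finite_permutations)
  qed
  then have "Mser I J $ m = ?L id $ m" if "m = 0 \<or> m = 1" for m
    using that by (simp add: sign_id)
  then show "Mser I J $ 0 = 0" "Mser I J $ 1 = - (hY * tcoef (I ! (p - 1)) (J ! (p - 1)) 1)"
    using i by simp_all
qed

text \<open>The minor starts at order one, so the inverse of \<open>A_p\<close> enters only through
  its constant term \<open>1\<close>. Division by \<open>h\<close> and the outer sign then undo the
  factor \<open>- h\<close>.\<close>

lemma E_ser_nth_1: "p \<ge> 1 \<Longrightarrow> E_ser p $ 1 = e_gen p (Suc p)"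
proof -
  assume p: "p \<ge> 1"
  let ?M = "Mser ([1..<p] @ [Suc p]) [1..<Suc p]"
  have "?M $ 0 = 0" "?M $ 1 = - (hY * tcoef (([1..<p] @ [Suc p]) ! (p - 1)) ([1..<Suc p] ! (p - 1)) 1)"
    using p by (intro Mser_nth_01; auto simp: nth_append simp del: upt_Suc)+
  then have "(?M * fps_right_inverse (A_ser p) 1) $ 1 = hY * (- e_gen p (Suc p))"
    using p by (simp add: fps_mult_nth_1 nth_append e_gen_def del: upt_Suc)
  then show ?thesis
    unfolding E_ser_def fps_nth_Abs_fps by (simp only: div_h_hY_mult minus_minus)
qed

lemma F_ser_nth_1: "p \<ge> 1 \<Longrightarrow> F_ser p $ 1 = e_gen (Suc p) p"
proof -
  assume p: "p \<ge> 1"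
  let ?M = "Mser [1..<Suc p] ([1..<p] @ [Suc p])"
  have "?M $ 0 = 0" "?M $ 1 = - (hY * tcoef ([1..<Suc p] ! (p - 1)) (([1..<p] @ [Suc p]) ! (p - 1)) 1)"
    using p by (intro Mser_nth_01; auto simp: nth_append simp del: upt_Suc)+
  then have "(fps_right_inverse (A_ser p) 1 * ?M) $ 1 = hY * (- e_gen (Suc p) p)"
    using p by (simp add: fps_mult_nth_1 nth_append e_gen_def del: upt_Suc)
  then show ?thesis
    unfolding F_ser_def fps_nth_Abs_fps by (simp only: div_h_hY_mult minus_minus)
qed

subsection \<open>Relations\<close>

lemma free_carrierI:
  "(\<And>w. w \<in> Poly_Mapping.keys x \<Longrightarrow> set (letters w) \<subseteq> {1..N} \<times> {1..N} \<times> {1..}) \<Longrightarrow> x \<in> free_carrier N"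
  by (simp add: free_carrier_def)

lemma free_carrier_diff: "x \<in> free_carrier N \<Longrightarrow> y \<in> free_carrier N \<Longrightarrow> x - y \<in> free_carrier N"
proof -
  assume "x \<in> free_carrier N" "y \<in> free_carrier N"
  moreover have "Poly_Mapping.keys (x - y) \<subseteq> Poly_Mapping.keys x \<union> Poly_Mapping.keys y"
    using Poly_Mapping.keys_add[of x "- y"] by simp
  ultimately show ?thesis
    unfolding free_carrier_def by blast
qed

lemma free_carrier_mult: "x \<in> free_carrier N \<Longrightarrow> y \<in> free_carrier N \<Longrightarrow> x * y \<in> free_carrier N"
proof (rule free_carrierI)
  fix w assume xy: "x \<in> free_carrier N" "y \<in> free_carrier N" and "w \<in> Poly_Mapping.keys (x * y)"
  then obtain a b where "w = a + b" "a \<in> Poly_Mapping.keys x" "b \<in> Poly_Mapping.keys y"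
    using keys_mult[of x y] by auto
  then show "set (letters w) \<subseteq> {1..N} \<times> {1..N} \<times> {1..}"
    using xy unfolding free_carrier_def plus_fword_def by fastforce
qed

lemma yconst_free_carrier: "yconst p \<in> free_carrier N"
  by (auto simp: free_carrier_def yconst_def zero_fword_def)

lemma one_free_carrier: "1 \<in> free_carrier N"
  using yconst_free_carrier[of 1] by simp

lemma tcoef_free_carrier: "i \<in> {1..N} \<Longrightarrow> j \<in> {1..N} \<Longrightarrow> tcoef i j s \<in> free_carrier N"
  using one_free_carrier[of N] free_carrier_diff[OF one_free_carrier one_free_carrier]
  by (auto simp: tcoef_def, auto simp: free_carrier_def)

lemma yang_rel_free_carrier: "{i, j, k, l} \<subseteq> {1..N} \<Longrightarrow> yang_rel i j k l r s \<in> free_carrier N"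
  unfolding yang_rel_def insert_subset
  by (elim conjE) (intro free_carrier_diff free_carrier_mult tcoef_free_carrier; assumption)

abbreviation yang_rels :: "nat \<Rightarrow> free_alg set" where
  "yang_rels N \<equiv> {yang_rel i j k l r s | i j k l r s. {i, j, k, l} \<subseteq> {1..N}}"

interpretation yang: genideal_quotient "free_carrier N" "yang_rels N"
  rewrites "genideal_quotient.I (free_carrier N) (yang_rels N) = yang_ideal N"
    and "genideal_quotient.Q (free_carrier N) (yang_rels N) = Yh N"
    and "genideal_quotient.cls (free_carrier N) (yang_rels N) = ycls N"
  for N
proof -
  show *: "genideal_quotient (free_carrier N) (yang_rels N)"
  proof
    show "yang_rels N \<subseteq> free_carrier N"
    proof
      fix x assume "x \<in> yang_rels N"
      then obtain i j k l r s where "x = yang_rel i j k l r s" "{i, j, k, l} \<subseteq> {1..N}"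
        by (elim CollectE exE conjE) (rule that)
      then show "x \<in> free_carrier N"
        by (simp only: yang_rel_free_carrier)
    qed
  qed (simp_all add: one_free_carrier free_carrier_diff free_carrier_mult)
  show I: "genideal_quotient.I (free_carrier N) (yang_rels N) = yang_ideal N"
    by (simp only: genideal_quotient.I_def[OF *] yang_ideal_def)
  show "genideal_quotient.Q (free_carrier N) (yang_rels N) = Yh N"
    by (simp only: genideal_quotient.Q_def[OF *] Yh_def I)
  show "genideal_quotient.cls (free_carrier N) (yang_rels N) = ycls N"
    by (rule ext) (simp only: genideal_quotient.cls_def[OF *] ycls_def I)
qed

text \<open>\<open>rho\<close> is constrained only on \<open>Ytilde\<close>, so membership must be
  certified for every element that acts. Doing this for free representatives keeps the computations
  out of the quotient.\<close>

definition Yadm :: "nat \<Rightarrow> free_alg set" where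
  "Yadm N = {x \<in> free_carrier N. ycls N x \<in> Ytilde N}"

lemma Yadm_add: "x \<in> Yadm N \<Longrightarrow> y \<in> Yadm N \<Longrightarrow> x + y \<in> Yadm N"
  using generate_ring.eng_add[of "ycls N x" "Yh N" _ "ycls N y"]
  by (auto simp: Yadm_def Ytilde_def yang.add_mem yang.cls_add)

lemma Yadm_mult: "x \<in> Yadm N \<Longrightarrow> y \<in> Yadm N \<Longrightarrow> x * y \<in> Yadm N"
  using generate_ring.eng_mult[of "ycls N x" "Yh N" _ "ycls N y"]
  by (auto simp: Yadm_def Ytilde_def yang.mult_mem yang.cls_mult)

lemma Yadm_uminus: "x \<in> Yadm N \<Longrightarrow> - x \<in> Yadm N"
  using generate_ring.a_inv[of "ycls N x" "Yh N"]
  by (auto simp: Yadm_def Ytilde_def yang.uminus_mem yang.cls_uminus)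

lemma Yadm_diff: "x \<in> Yadm N \<Longrightarrow> y \<in> Yadm N \<Longrightarrow> x - y \<in> Yadm N"
  using Yadm_add[OF _ Yadm_uminus, of x N y] by simp

lemma Yadm_yconst: "yconst p \<in> Yadm N"
  by (auto simp: Yadm_def Ytilde_def yconst_free_carrier intro!: generate_ring.incl)

lemma Yadm_hY: "hY \<in> Yadm N"
  by (simp add: hY_def Yadm_yconst)

lemma Yadm_one: "1 \<in> Yadm N"
  using Yadm_yconst[of 1] by simp

lemma Yadm_zero: "0 \<in> Yadm N"
  using Yadm_diff[OF Yadm_one Yadm_one] by simp

lemma Yadm_of_nat: "of_nat k \<in> Yadm N"
  by (induction k) (auto simp: Yadm_zero Yadm_one Yadm_add)

lemma Yadm_sum: "(\<And>i. i \<in> A \<Longrightarrow> f i \<in> Yadm N) \<Longrightarrow> sum f A \<in> Yadm N"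
  by (induction A rule: infinite_finite_induct) (auto simp: Yadm_zero Yadm_add)

lemma Yadm_tcoef:
  assumes "i \<in> {1..N}" "j \<in> {1..N}" "s \<ge> 1"
  shows "(- hY) ^ (s - 1) * tcoef i j s \<in> Yadm N"
proof -
  have "- hY \<in> free_carrier N"
    by (simp add: hY_def yang.uminus_mem yconst_free_carrier)
  then show ?thesis
    using assms by (auto simp: Yadm_def Ytilde_def intro!: generate_ring.incl yang.mult_mem
      yang.power_mem tcoef_free_carrier)
qed

lemma Yadm_e_gen: "i \<in> {1..N} \<Longrightarrow> j \<in> {1..N} \<Longrightarrow> e_gen i j \<in> Yadm N"
  using Yadm_tcoef[of j N i 1] by (simp add: e_gen_def)

lemma Yadm_hY_tcoef_2: "i \<in> {1..N} \<Longrightarrow> hY * tcoef i i 2 \<in> Yadm N"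
  using Yadm_uminus[OF Yadm_tcoef[of i N i 2]] by simp

lemmas Yadm_intros = Yadm_add Yadm_diff Yadm_uminus Yadm_mult Yadm_sum Yadm_yconst Yadm_hY
  Yadm_of_nat Yadm_one Yadm_e_gen Yadm_hY_tcoef_2

lemma Yadm_Z_el: "i \<in> {1..N} \<Longrightarrow> Z_el i \<in> Yadm N"
  unfolding Z_el_def distrib_left by (intro Yadm_intros) auto

lemma e_gen_commutator:
  assumes "{i, j, k, l} \<subseteq> {1..N}"
  shows "ycls N (e_gen i j * e_gen k l - e_gen k l * e_gen i j) =
    ycls N ((if j = k then e_gen i l else 0) - (if i = l then e_gen k j else 0))"
proof -
  have "{j, i, l, k} \<subseteq> {1..N}"
    using assms by simp
  \<comment> \<open>With \<open>r = 0\<close>, \<open>s = 1\<close> the second bracket is a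
    commutator with a scalar and vanishes; the first is the commutator of the \<open>e\<close>'s,
    whose indices are transposed in \<open>tcoef\<close>, and the third gives the delta
    terms.\<close>
  then have "yang_rel j i l k 0 1 \<in> yang_rels N"
    by (intro CollectI exI conjI) (rule refl)
  then have "yang_rel j i l k 0 1 \<in> yang_ideal N"
    using yang.gens_subset_I by (rule set_rev_mp)
  moreover have "yang_rel j i l k 0 1 = (e_gen i j * e_gen k l - e_gen k l * e_gen i j)
      - ((if j = k then e_gen i l else 0) - (if i = l then e_gen k j else 0))"
  proof -
    have t0: "tcoef a b 0 = (if a = b then 1 else 0)" for a b
      by (simp add: tcoef_def)
    show ?thesis
      unfolding yang_rel_def e_gen_def t0 by simp
  qed
  moreover have "e_gen a b \<in> free_carrier N" if "{a, b} \<subseteq> {1..N}" for a b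
    using that by (simp add: e_gen_def tcoef_free_carrier)
  then have "e_gen i j * e_gen k l - e_gen k l * e_gen i j \<in> free_carrier N"
    "(if j = k then e_gen i l else 0) - (if i = l then e_gen k j else 0) \<in> free_carrier N"
    using assms by (auto simp: yang.zero_mem yang.uminus_mem intro!: free_carrier_diff free_carrier_mult)
  ultimately show ?thesis
    by (simp only: yang.cls_eq_iff)
qed

section \<open>The action\<close>

lemma move_unit_comps:
  assumes "mu \<in> comps N n" "a \<in> {1..N}" "b \<in> {1..N}" "a \<noteq> b" "mu a \<noteq> 0"
  shows "move_unit a b mu \<in> comps N n"
proof -
  \<comment> \<open>Adding the indicators on both sides avoids truncated subtraction at
    \<open>a\<close>.\<close>
  have "(\<Sum>x=1..N. move_unit a b mu x + (if x = a then 1 else 0)) = (\<Sum>x=1..N. mu x + (if x = b then 1 else 0))"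
    using assms by (intro sum.cong) (auto simp: move_unit_def)
  then show ?thesis
    using assms unfolding sum.distrib by (auto simp: comps_def move_unit_def)
qed

lemma poly_pconst_Hv_base: "poly (map_poly pconst c) (pv Hv) \<in> polys_in (base_vars n)"
  by (induction c) (auto simp: map_poly_pCons Hv_base intro!: polys_in_add polys_in_mult)

lemma choose_2_add: "(a + b) choose 2 = (a choose 2) + (b choose 2) + a * b" for a b :: nat
proof -
  have "Suc k choose 2 = k + (k choose 2)" for k
    by (simp add: numeral_2_eq_2)
  then show ?thesis
    by (induction b) (simp_all add: numeral_2_eq_2)
qed

lemma pconst_half_choose: "pconst (1/2) * (of_nat m * (of_nat m - 1)) = of_nat (m choose 2)"
proof -
  have "2 * of_nat (m choose 2) = of_nat m * (of_nat m - (1::complex))"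
  proof (induction m)
    case (Suc m)
    have "Suc m choose 2 = m + (m choose 2)"
      by (simp add: numeral_2_eq_2)
    then show ?case
      using Suc by (simp add: algebra_simps)
  qed (simp add: numeral_2_eq_2)
  then have "(1/2) * (of_nat m * (of_nat m - 1)) = (of_nat (m choose 2) :: complex)"
    by (simp add: field_simps)
  then have "pconst ((1/2) * (of_nat m * (of_nat m - 1))) = pconst (of_nat (m choose 2))"
    by simp
  then show ?thesis
    by (simp only: pconst_mult pconst_diff pconst_of_nat pconst_one)
qed

section \<open>Families supported on a single summand\<close>

lemma HX_incl_mem:
  "mu \<in> comps N n \<Longrightarrow> f \<in> sym_polys N n mu \<Longrightarrow> HX_incl N n mu (hcls N n mu f) \<in> HX N n"
  unfolding HX_def HX_incl_def by (auto simp: coh.cls_zero intro!: coh.cls_closed coh.zero_mem)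

lemma HX_add_incl:
  assumes "f \<in> sym_polys N n mu" "g \<in> sym_polys N n mu"
  shows "HX_add N n (HX_incl N n mu (hcls N n mu f)) (HX_incl N n mu (hcls N n mu g))
    = HX_incl N n mu (hcls N n mu (f + g))"
  unfolding HX_add_def HX_incl_def
  using assms by (intro ext) (auto simp: coh.cls_zero coh.cls_add coh.zero_mem)

lemma HX_scale_incl:
  assumes "c \<in> polys_in (base_vars n)" "f \<in> sym_polys N n mu"
  shows "HX_scale N n c (HX_incl N n mu (hcls N n mu f)) = HX_incl N n mu (hcls N n mu (c * f))"
  unfolding HX_scale_def HX_incl_def
  using assms base_in_sym_polys[OF assms(1)]
  by (intro ext) (auto simp: coh.cls_zero coh.cls_mult coh.zero_mem)

lemma HX_incl_zero: "HX_incl N n mu (hcls N n mu 0) = HX_zero N n"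
  unfolding HX_incl_def HX_zero_def by (intro ext) (auto simp: coh.cls_zero)

text \<open>Division by \<open>h\<close>, one summand at a time, by \<open>coh_torsion_free\<close>.
  Summands other than \<open>mu\<close> are compared with \<open>0\<close>, so the support of
  \<open>v\<close> is recovered as well.\<close>

lemma HX_scale_Hv_cancel:
  assumes v: "v \<in> HX N n" and g: "g \<in> sym_polys N n mu" and "mu \<in> comps N n"
    and eq: "HX_scale N n (pv Hv) v = HX_incl N n mu (hcls N n mu (pv Hv * g))"
  shows "v = HX_incl N n mu (hcls N n mu g)"
proof
  fix nu
  show "v nu = HX_incl N n mu (hcls N n mu g) nu"
  proof (cases "nu \<in> comps N n")
    case True
    then have "v nu \<in> hcls N n nu ` sym_polys N n nu"
      using v PiE_mem[of v "comps N n" _ nu] unfolding HX_def coh.carrier_Q by simp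
    then obtain k where k: "k \<in> sym_polys N n nu" "v nu = hcls N n nu k"
      by (rule imageE) (rule that)
    define g' where "g' = (if nu = mu then g else 0)"
    have g': "g' \<in> sym_polys N n nu"
      using g by (auto simp: g'_def coh.zero_mem)
    have "hcls N n nu (pv Hv * k) = hcls N n nu (pv Hv * g')"
    proof -
      have "HX_scale N n (pv Hv) v nu = hcls N n nu (pv Hv * k)"
        using True k by (simp add: HX_scale_def coh.cls_mult)
      moreover have "HX_incl N n mu (hcls N n mu (pv Hv * g)) nu = hcls N n nu (pv Hv * g')"
        using True by (simp add: HX_incl_def g'_def coh.cls_zero)
      ultimately show ?thesis
        using eq by simp
    qed
    then have "pv Hv * k - pv Hv * g' \<in> coh_ideal N n nu"
      using k g' by (simp add: coh.cls_eq_iff coh.mult_mem)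
    then have "k - g' \<in> coh_ideal N n nu"
      by (rule coh_torsion_free[of "k - g'", unfolded right_diff_distrib])
    then have "hcls N n nu k = hcls N n nu g'"
      using k g' by (simp add: coh.cls_eq_iff)
    then show ?thesis
      using True k by (simp add: HX_incl_def g'_def coh.cls_zero)
  next
    case False
    then show ?thesis
      using v PiE_arb[of v "comps N n" _ nu] by (simp add: HX_incl_def HX_def)
  qed
qed

context yangian_action
begin

text \<open>Relates polynomials rather than classes, so that degree bounds can be attached to
  \<open>g\<close>; \<open>g\<close> is determined only modulo the ideal.\<close>

definition acts :: "free_alg \<Rightarrow> (nat \<Rightarrow> nat) \<Rightarrow> mpol \<Rightarrow> (nat \<Rightarrow> nat) \<Rightarrow> mpol \<Rightarrow> bool" where
  "acts x mu f nu g \<longleftrightarrow> x \<in> Yadm N \<and> mu \<in> comps N n \<and> nu \<in> comps N n \<and>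
     f \<in> sym_polys N n mu \<and> g \<in> sym_polys N n nu \<and>
     rho (ycls N x) (HX_incl N n mu (hcls N n mu f)) = HX_incl N n nu (hcls N n nu g)"

lemma acts_add:
  assumes "acts x mu f nu g" "acts y mu f nu g'"
  shows "acts (x + y) mu f nu (g + g')"
proof -
  have "ycls N (x + y) = ycls N x \<oplus>\<^bsub>Yh N\<^esub> ycls N y"
    using assms by (simp add: acts_def Yadm_def yang.cls_add)
  moreover have "ycls N x \<in> Ytilde N" "ycls N y \<in> Ytilde N"
    using assms by (auto simp: acts_def Yadm_def)
  ultimately show ?thesis
    using assms by (auto simp: acts_def Yadm_add coh.add_mem rho_add_left HX_incl_mem HX_add_incl)
qed

lemma acts_mult:
  assumes "acts y mu f nu g" "acts x nu g ka k"
  shows "acts (x * y) mu f ka k"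
proof -
  have "ycls N (x * y) = ycls N x \<otimes>\<^bsub>Yh N\<^esub> ycls N y"
    using assms by (simp add: acts_def Yadm_def yang.cls_mult)
  then show ?thesis
    using assms Yadm_mult[of x N y] rho_mult[of "ycls N x" "ycls N y"]
    by (auto simp: acts_def HX_incl_mem Yadm_def)
qed

lemma acts_const:
  assumes "mu \<in> comps N n" "f \<in> sym_polys N n mu"
  shows "acts (yconst c) mu f mu (poly (map_poly pconst c) (pv Hv) * f)"
  using assms poly_pconst_Hv_base[of c n] base_in_sym_polys[OF poly_pconst_Hv_base[of c n]]
  by (auto simp: acts_def Yadm_yconst rho_const HX_incl_mem HX_scale_incl coh.mult_mem)

lemma acts_const_mult:
  assumes "acts x mu f nu g"
  shows "acts (yconst c * x) mu f nu (poly (map_poly pconst c) (pv Hv) * g)"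
  using assms by (intro acts_mult[OF assms] acts_const) (auto simp: acts_def)

lemma acts_scalar_mult: "acts x mu f nu g \<Longrightarrow> acts (yconst [:a:] * x) mu f nu (pconst a * g)"
  using acts_const_mult[of x mu f nu g "[:a:]"] by (simp add: map_poly_pCons)

lemma acts_hY_mult: "acts x mu f nu g \<Longrightarrow> acts (hY * x) mu f nu (pv Hv * g)"
  using acts_const_mult[of x mu f nu g "[:0, 1:]"] by (simp add: map_poly_pCons hY_def)

lemma acts_uminus: "acts x mu f nu g \<Longrightarrow> acts (- x) mu f nu (- g)"
proof -
  assume "acts x mu f nu g"
  moreover have "yconst [:- 1:] = - 1"
  proof -
    have "[:- 1:] = (- 1 :: complex poly)"
      by (simp add: one_pCons)
    then show ?thesis
      by (simp add: yconst_def single_uminus)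
  qed
  ultimately show ?thesis
    using acts_scalar_mult[of x mu f nu g "- 1"] by (simp add: pconst_uminus)
qed

lemma acts_diff: "acts x mu f nu g \<Longrightarrow> acts y mu f nu g' \<Longrightarrow> acts (x - y) mu f nu (g - g')"
  using acts_add[OF _ acts_uminus, of x mu f nu g y g'] by simp

lemma acts_zero: "mu \<in> comps N n \<Longrightarrow> f \<in> sym_polys N n mu \<Longrightarrow> acts 0 mu f mu 0"
  using acts_const[of mu f 0] by (simp add: yconst_def)

lemma acts_one: "mu \<in> comps N n \<Longrightarrow> f \<in> sym_polys N n mu \<Longrightarrow> acts 1 mu f mu f"
  using acts_const[of mu f 1] by (simp add: map_poly_1')

lemma acts_sum:
  assumes "mu \<in> comps N n" "f \<in> sym_polys N n mu" "\<And>j. j \<in> A \<Longrightarrow> acts (x j) mu f mu (g j)"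
  shows "acts (sum x A) mu f mu (sum g A)"
  using assms(3)
  by (induction A rule: infinite_finite_induct) (auto intro: acts_zero[OF assms(1,2)] acts_add)

lemma acts_cong_left: "acts x mu f nu g \<Longrightarrow> ycls N x = ycls N y \<Longrightarrow> y \<in> Yadm N \<Longrightarrow> acts y mu f nu g"
  by (simp add: acts_def)

text \<open>All summands share the zero family. Vanishing can thus be recorded at any valid index,
  also when the shifted one does not exist.\<close>

lemma acts_zero_index: "acts x mu f nu 0 \<Longrightarrow> ka \<in> comps N n \<Longrightarrow> acts x mu f ka 0"
  by (simp add: acts_def HX_incl_zero coh.zero_mem)

text \<open>The zero family is what the class of \<open>0\<close> makes of it, so
  \<open>x * 0 = 0\<close> in \<open>Yh\<close> and \<open>rho_mult\<close> give the claim.\<close>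

lemma acts_zero_right:
  assumes "x \<in> Yadm N" "mu \<in> comps N n" "nu \<in> comps N n"
  shows "acts x mu 0 nu 0"
proof -
  have "HX_zero N n \<in> HX N n"
    using HX_incl_mem[OF assms(2) coh.zero_mem] by (simp add: HX_incl_zero)
  have "rho (ycls N 0) (HX_zero N n) = HX_zero N n"
    using acts_zero[OF assms(2) coh.zero_mem] by (simp add: acts_def HX_incl_zero)
  moreover have "ycls N 0 \<in> Ytilde N" "ycls N x \<in> Ytilde N"
    using assms(1) acts_zero[OF assms(2) coh.zero_mem] by (auto simp: acts_def Yadm_def)
  moreover have "ycls N x \<otimes>\<^bsub>Yh N\<^esub> ycls N 0 = ycls N 0"
    using assms(1) by (simp add: yang.cls_mult Yadm_def yang.zero_mem)
  ultimately have "rho (ycls N x) (HX_zero N n) = HX_zero N n"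
    using rho_mult[of "ycls N x" "ycls N 0" "HX_zero N n"] \<open>HX_zero N n \<in> HX N n\<close> by simp
  then show ?thesis
    using assms by (simp add: acts_def HX_incl_zero coh.zero_mem)
qed

text \<open>The coefficients of \<open>A_p\<close> yield only \<open>h\<close> times the wanted
  elements; torsion-freeness removes the factor.\<close>

lemma acts_hY_cancel:
  assumes "x \<in> Yadm N" "acts (hY * x) mu f mu (pv Hv * g)" "g \<in> sym_polys N n mu"
  shows "acts x mu f mu g"
proof -
  let ?v = "rho (ycls N x) (HX_incl N n mu (hcls N n mu f))"
  have incl: "HX_incl N n mu (hcls N n mu f) \<in> HX N n"
    using assms by (auto simp: acts_def intro: HX_incl_mem)
  have v: "?v \<in> HX N n"
    using assms(1) incl by (auto simp: Yadm_def intro: rho_closed)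
  have "ycls N (hY * x) = ycls N hY \<otimes>\<^bsub>Yh N\<^esub> ycls N x"
    using assms(1) Yadm_hY[of N] by (simp add: Yadm_def yang.cls_mult)
  then have "rho (ycls N (hY * x)) (HX_incl N n mu (hcls N n mu f)) = HX_scale N n (pv Hv) ?v"
    using assms(1) Yadm_hY[of N] rho_mult[OF _ _ incl, of "ycls N hY" "ycls N x"] rho_const[OF v, of "[:0, 1:]"]
    by (simp add: Yadm_def hY_def map_poly_pCons)
  then have "?v = HX_incl N n mu (hcls N n mu g)"
    using assms(2,3) by (intro HX_scale_Hv_cancel[OF v]) (auto simp: acts_def)
  then show ?thesis
    using assms by (auto simp: acts_def)
qed

subsection \<open>Weights and the limit Hamiltonian\<close>

lemma acts_sum_e_gen_diag:
  assumes "mu \<in> comps N n" "f \<in> sym_polys N n mu" "p \<le> N"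
  shows "acts (\<Sum>k=1..p. e_gen k k) mu f mu (of_nat (\<Sum>k=1..p. mu k) * f)"
proof (cases "p = 0")
  \<comment> \<open>\<open>rho_A\<close> begins at \<open>p = 1\<close>, but the empty sum is the
    subtrahend when the operator of index \<open>1\<close> is extracted.\<close>
  case True
  then show ?thesis using acts_zero[OF assms(1,2)] by simp
next
  case False
  let ?W = "\<Sum>k=1..p. e_gen k k" and ?L = "\<Sum>k=1..p. mu k"
  have W: "?W \<in> Yadm N"
    using assms by (intro Yadm_intros) auto
  have L: "of_nat ?L * f \<in> sym_polys N n mu"
    using assms by (intro coh.mult_mem coh.of_nat_mem)
  have "acts (- (hY * ?W)) mu f mu (- (pv Hv * (of_nat ?L * f)))"
    using rho_A[of p mu f 1] False assms W L
    by (auto simp: acts_def A_ser_nth_1[unfolded One_nat_def] A_fun_nth[unfolded One_nat_def] algebra_simps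
        intro!: Yadm_intros coh.uminus_mem coh.mult_mem coh.sum_mem coh.of_nat_mem)
  then have "acts (hY * ?W) mu f mu (pv Hv * (of_nat ?L * f))"
    using acts_uminus by fastforce
  then show ?thesis
    using acts_hY_cancel[OF W _ L] by blast
qed

lemma acts_e_gen_diag:
  assumes "mu \<in> comps N n" "f \<in> sym_polys N n mu" "k \<in> {1..N}"
  shows "acts (e_gen k k) mu f mu (of_nat (mu k) * f)"
proof -
  obtain m where m: "k = Suc m" "m \<le> N" "Suc m \<le> N"
    using assms(3) by (cases k) auto
  show ?thesis
    using acts_diff[OF acts_sum_e_gen_diag[OF assms(1,2) m(3)] acts_sum_e_gen_diag[OF assms(1,2) m(2)]]
    by (simp add: m(1) algebra_simps)
qed

lemma acts_sum_Z_el: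
  fixes mu :: "nat \<Rightarrow> nat" and p :: nat
  assumes "mu \<in> comps N n" "f \<in> sym_polys N n mu" "p \<le> N"
  shows "acts (\<Sum>k=1..p. Z_el k) mu f mu
    ((of_nat ((\<Sum>k=1..p. mu k) choose 2) * pv Hv - (\<Sum>a=1..p. \<Sum>i=1..mu a. pv (Gam a i))) * f)"
proof (cases "p = 0")
  case True
  then show ?thesis using acts_zero[OF assms(1,2)] by (simp add: numeral_2_eq_2)
next
  case False
  let ?W = "\<Sum>k=1..p. Z_el k"
    and ?g = "(of_nat ((\<Sum>k=1..p. mu k) choose 2) * pv Hv - (\<Sum>a=1..p. \<Sum>i=1..mu a. pv (Gam a i))) * f"
  have W: "?W \<in> Yadm N"
    using assms by (intro Yadm_sum Yadm_Z_el) auto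
  have g: "?g \<in> sym_polys N n mu"
    using assms by (intro coh.mult_mem coh.diff_mem coh.of_nat_mem coh.sum_mem D_sym Hv_sym) auto
  have eq: "pv Hv * ?g = A_fun mu p f $ 2"
    unfolding A_fun_nth by (simp add: algebra_simps power2_eq_square)
  have "acts (hY * ?W) mu f mu (pv Hv * ?g)"
    using rho_A[of p mu f 2] False assms W g unfolding eq[symmetric] acts_def A_ser_nth_2[symmetric]
    by (auto simp: A_ser_nth_2 intro!: Yadm_mult Yadm_hY coh.mult_mem)
  then show ?thesis
    using acts_hY_cancel[OF W _ g] by blast
qed

text \<open>With \<open>L\<close> the sum of the earlier weights and \<open>m = mu i\<close>,
  \<open>Z_el i\<close> acts by \<open>((L + m choose 2) - (L choose 2)) h - D_i\<close>, and
  \<open>X_inf i + Z_el i\<close> by \<open>((m choose 2) + L m) h\<close>.\<close>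

lemma acts_X_inf:
  assumes mu: "mu \<in> comps N n" and f: "f \<in> sym_polys N n mu" and i: "i \<in> {1..N}"
  shows "acts (X_inf i) mu f mu ((\<Sum>j=1..mu i. pv (Gam i j)) * f)"
proof -
  obtain m where m: "i = Suc m" "m \<le> N" "Suc m \<le> N"
    using i by (cases i) auto
  let ?L = "\<Sum>k=1..m. mu k" and ?D = "\<Sum>j=1..mu i. pv (Gam i j)"
  have *: "{1..<i} = {1..m}"
    using m by auto
  have "acts (Z_el i) mu f mu
     ((of_nat ((?L + mu i) choose 2) * pv Hv - of_nat (?L choose 2) * pv Hv - ?D) * f)"
    using acts_diff[OF acts_sum_Z_el[OF mu f m(3)] acts_sum_Z_el[OF mu f m(2)]]
    by (simp add: m(1) algebra_simps)
  moreover have "acts (yconst [:0, 1/2:] * (e_gen i i * (e_gen i i - 1))) mu f mu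
      (poly (map_poly pconst [:0, 1/2:]) (pv Hv) * (of_nat (mu i) * (of_nat (mu i) * f - f)))"
  proof -
    have "acts (e_gen i i - 1) mu f mu (of_nat (mu i) * f - f)"
      by (intro acts_diff acts_one acts_e_gen_diag mu f i)
    then show ?thesis
      by (rule acts_const_mult[OF acts_mult[OF _ acts_e_gen_diag[OF mu _ i]]])
        (intro coh.diff_mem coh.mult_mem coh.of_nat_mem f)
  qed
  moreover have "acts (hY * (\<Sum>k=1..<i. e_gen k k * e_gen i i)) mu f mu
      (pv Hv * (\<Sum>k=1..<i. of_nat (mu k) * (of_nat (mu i) * f)))"
  proof -
    have "acts (e_gen k k * e_gen i i) mu f mu (of_nat (mu k) * (of_nat (mu i) * f))"
      if "k \<in> {1..<i}" for k
      using that i by (intro acts_mult[OF acts_e_gen_diag[OF mu f i]] acts_e_gen_diag mu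
          coh.mult_mem coh.of_nat_mem f) auto
    then show ?thesis
      by (intro acts_hY_mult acts_sum mu f)
  qed
  ultimately have "acts (X_inf i + Z_el i - Z_el i) mu f mu
     (poly (map_poly pconst [:0, 1/2:]) (pv Hv) * (of_nat (mu i) * (of_nat (mu i) * f - f)) +
      pv Hv * (\<Sum>k=1..<i. of_nat (mu k) * (of_nat (mu i) * f)) -
      (of_nat ((?L + mu i) choose 2) * pv Hv - of_nat (?L choose 2) * pv Hv - ?D) * f)"
    unfolding X_inf_plus_Z_el by (intro acts_add acts_diff)
  moreover have "poly (map_poly pconst [:0, 1/2:]) (pv Hv) * (of_nat (mu i) * (of_nat (mu i) * f - f))
      = of_nat (mu i choose 2) * pv Hv * f"
    unfolding pconst_half_choose[symmetric] by (simp add: map_poly_pCons algebra_simps)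
  moreover have "(\<Sum>k=1..<i. of_nat (mu k) * (of_nat (mu i) * f)) = of_nat (?L * mu i) * f"
    unfolding * by (simp add: sum_distrib_right mult.assoc)
  ultimately show ?thesis
    unfolding choose_2_add by (simp add: algebra_simps)
qed

subsection \<open>Root vectors\<close>

text \<open>One \<open>g\<close> must satisfy the bounds for all \<open>d\<close>, so that
  specifications compose. The case \<open>mu j = 0\<close> is stated at \<open>mu\<close>, since
  \<open>move_unit\<close> would then raise the total.\<close>

definition e_spec :: "nat \<Rightarrow> nat \<Rightarrow> bool" where
  "e_spec i j \<longleftrightarrow> (\<forall>mu\<in>comps N n. \<forall>f\<in>sym_polys N n mu.
     (mu j = 0 \<longrightarrow> acts (e_gen i j) mu f mu 0) \<and>
     (mu j \<noteq> 0 \<longrightarrow> (\<exists>g. acts (e_gen i j) mu f (move_unit j i mu) g \<and>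
        (\<forall>d. tdeg_le f d \<longrightarrow> tdeg_le g (d + int (mu j) - int (mu i) - 1)))))"

lemma e_spec_E:
  assumes p: "p \<in> {1..<N}"
  shows "e_spec p (Suc p)"
  unfolding e_spec_def
proof (intro ballI conjI impI)
  fix mu f assume mu: "mu \<in> comps N n" and f: "f \<in> sym_polys N n mu"
  have e: "e_gen p (Suc p) \<in> Yadm N" "E_ser p $ 1 = e_gen p (Suc p)"
    using p E_ser_nth_1[of p] Yadm_e_gen[of p N "Suc p"] by auto
  show "acts (e_gen p (Suc p)) mu f mu 0" if "mu (Suc p) = 0"
    using rho_E_zero[OF p mu f that, of 1] mu f e by (simp add: acts_def HX_incl_zero coh.zero_mem)
  assume nz: "mu (Suc p) \<noteq> 0"
  let ?nu = "move_unit (Suc p) p mu"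
  obtain g where g: "g \<in> sym_polys N n ?nu" "to_frac g = E_fun ?nu p f $ 1"
    "rho (ycls N (E_ser p $ 1)) (HX_incl N n mu (hcls N n mu f)) = HX_incl N n ?nu (hcls N n ?nu g)"
    using rho_E[OF p mu f nz refl, of 1] by blast
  have "?nu \<in> comps N n"
    using p nz by (intro move_unit_comps mu) auto
  then have "acts (e_gen p (Suc p)) mu f ?nu g"
    using g mu f e by (simp add: acts_def)
  moreover have "tdeg_le g (d + int (mu (Suc p)) - int (mu p) - 1)" if "tdeg_le f d" for d
  proof -
    \<comment> \<open>\<open>E_fun_tdeg\<close> counts in the target, where group \<open>p\<close>
      has one root more and group \<open>Suc p\<close> one less than in \<open>mu\<close>.\<close>
    have "d - int (?nu p) + 1 + int (?nu (Suc p)) = d + int (mu (Suc p)) - int (mu p) - 1"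
      using nz by (simp add: move_unit_def of_nat_diff)
    then show ?thesis
      using E_fun_tdeg[OF that, of ?nu p] g(2) by (metis tdeg_le_of_frac)
  qed
  ultimately show "\<exists>g. acts (e_gen p (Suc p)) mu f ?nu g \<and>
      (\<forall>d. tdeg_le f d \<longrightarrow> tdeg_le g (d + int (mu (Suc p)) - int (mu p) - 1))"
    by blast
qed

lemma e_spec_F:
  assumes p: "p \<in> {1..<N}"
  shows "e_spec (Suc p) p"
  unfolding e_spec_def
proof (intro ballI conjI impI)
  fix mu f assume mu: "mu \<in> comps N n" and f: "f \<in> sym_polys N n mu"
  have e: "e_gen (Suc p) p \<in> Yadm N" "F_ser p $ 1 = e_gen (Suc p) p"
    using p F_ser_nth_1[of p] Yadm_e_gen[of "Suc p" N p] by auto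
  show "acts (e_gen (Suc p) p) mu f mu 0" if "mu p = 0"
    using rho_F_zero[OF p mu f that, of 1] mu f e by (simp add: acts_def HX_incl_zero coh.zero_mem)
  assume nz: "mu p \<noteq> 0"
  let ?nu = "move_unit p (Suc p) mu"
  obtain g where g: "g \<in> sym_polys N n ?nu" "to_frac g = F_fun ?nu p f $ 1"
    "rho (ycls N (F_ser p $ 1)) (HX_incl N n mu (hcls N n mu f)) = HX_incl N n ?nu (hcls N n ?nu g)"
    using rho_F[OF p mu f nz refl, of 1] by blast
  have "?nu \<in> comps N n"
    using p nz by (intro move_unit_comps mu) auto
  then have "acts (e_gen (Suc p) p) mu f ?nu g"
    using g mu f e by (simp add: acts_def)
  moreover have "tdeg_le g (d + int (mu p) - int (mu (Suc p)) - 1)" if "tdeg_le f d" for d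
  proof -
    have "d - int (?nu (Suc p)) + 1 + int (?nu p) = d + int (mu p) - int (mu (Suc p)) - 1"
      using nz by (simp add: move_unit_def of_nat_diff)
    then show ?thesis
      using F_fun_tdeg[OF that, of ?nu p] g(2) by (metis tdeg_le_of_frac)
  qed
  ultimately show "\<exists>g. acts (e_gen (Suc p) p) mu f ?nu g \<and>
      (\<forall>d. tdeg_le f d \<longrightarrow> tdeg_le g (d + int (mu p) - int (mu (Suc p)) - 1))"
    by blast
qed

text \<open>For \<open>i\<close> different from \<open>j\<close>,
  \<open>e_{i,j} = [e_{i,k}, e_{k,j}]\<close>, and both orders shift degrees alike:
  \<open>(mu_j - mu_k - 1) + ((mu_k + 1) - mu_i - 1)\<close> equals
  \<open>(mu_k - mu_i - 1) + (mu_j - (mu_k - 1) - 1)\<close>.\<close>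

lemma e_spec_trans:
  assumes ik: "e_spec i k" and kj: "e_spec k j"
    and ijk: "i \<in> {1..N}" "j \<in> {1..N}" "k \<in> {1..N}" "i \<noteq> k" "k \<noteq> j" "i \<noteq> j"
  shows "e_spec i j"
  unfolding e_spec_def
proof (intro ballI conjI impI)
  fix mu f assume mu: "mu \<in> comps N n" and f: "f \<in> sym_polys N n mu"
  have e: "e_gen i j \<in> Yadm N" "e_gen i k \<in> Yadm N" "e_gen k j \<in> Yadm N"
    using ijk by (auto intro!: Yadm_e_gen)
  have comm: "acts (e_gen i j) mu f nu (g - g')"
    if "acts (e_gen i k * e_gen k j) mu f nu g" "acts (e_gen k j * e_gen i k) mu f nu g'" for nu g g'
    using acts_cong_left[OF acts_diff[OF that], of "e_gen i j"] e_gen_commutator[of i k k j N] ijk e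
    by simp
  show "acts (e_gen i j) mu f mu 0" if "mu j = 0"
  proof -
    have "acts (e_gen i k * e_gen k j) mu f mu 0"
      using kj that mu f e by (intro acts_mult[of _ _ _ mu 0] acts_zero_right) (auto simp: e_spec_def)
    moreover have "acts (e_gen k j * e_gen i k) mu f mu 0"
    proof (cases "mu k = 0")
      case True
      then show ?thesis
        using ik mu f e by (intro acts_mult[of _ _ _ mu 0] acts_zero_right) (auto simp: e_spec_def)
    next
      case False
      then obtain g where g: "acts (e_gen i k) mu f (move_unit k i mu) g"
        using ik mu f unfolding e_spec_def by blast
      \<comment> \<open>Moving a unit from \<open>k\<close> to \<open>i\<close> leaves group
        \<open>j\<close> empty, so \<open>e_{k,j}\<close> still annihilates.\<close>
      have "move_unit k i mu j = 0"
        using that ijk by (simp add: move_unit_def)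
      then have "acts (e_gen k j) (move_unit k i mu) g (move_unit k i mu) 0"
        using kj g by (auto simp: e_spec_def acts_def)
      then show ?thesis
        using acts_zero_index[OF acts_mult[OF g] mu] by blast
    qed
    ultimately show ?thesis
      using comm[of mu 0 0] by simp
  qed
  assume nz: "mu j \<noteq> 0"
  let ?nu = "move_unit j i mu"
  have nu: "?nu \<in> comps N n"
    using nz ijk by (intro move_unit_comps mu) auto
  obtain g1 where g1: "acts (e_gen k j) mu f (move_unit j k mu) g1"
    "\<And>d. tdeg_le f d \<Longrightarrow> tdeg_le g1 (d + int (mu j) - int (mu k) - 1)"
    using kj mu f nz unfolding e_spec_def by blast
  have "move_unit k i (move_unit j k mu) = ?nu" "move_unit j k mu k \<noteq> 0"
    using ijk by (auto simp: move_unit_def fun_eq_iff)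
  then obtain g2 where g2: "acts (e_gen i k) (move_unit j k mu) g1 ?nu g2"
    "\<And>d. tdeg_le g1 d \<Longrightarrow> tdeg_le g2 (d + int (move_unit j k mu k) - int (move_unit j k mu i) - 1)"
    using ik g1(1) unfolding e_spec_def acts_def by metis
  have g2': "tdeg_le g2 (d + int (mu j) - int (mu i) - 1)" if "tdeg_le f d" for d
  proof -
    have "(d + int (mu j) - int (mu k) - 1) + int (move_unit j k mu k) - int (move_unit j k mu i) - 1
        = d + int (mu j) - int (mu i) - 1"
      using ijk by (simp add: move_unit_def)
    then show ?thesis
      using g2(2)[OF g1(2)[OF that]] by (simp only:)
  qed
  have "\<exists>g3. acts (e_gen k j * e_gen i k) mu f ?nu g3 \<and>
      (\<forall>d. tdeg_le f d \<longrightarrow> tdeg_le g3 (d + int (mu j) - int (mu i) - 1))"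
  proof (cases "mu k = 0")
    \<comment> \<open>Here \<open>e_{i,k}\<close> already kills \<open>f\<close>. The other order
      needs no such case, since group \<open>k\<close> has just received a unit.\<close>
    case True
    then have "acts (e_gen k j * e_gen i k) mu f ?nu 0"
      using ik mu f e nu by (intro acts_mult[of _ _ _ mu 0] acts_zero_right) (auto simp: e_spec_def)
    then show ?thesis
      by (intro exI[of _ 0]) (auto simp: tdeg_le_def)
  next
    case False
    obtain h1 where h1: "acts (e_gen i k) mu f (move_unit k i mu) h1"
      "\<And>d. tdeg_le f d \<Longrightarrow> tdeg_le h1 (d + int (mu k) - int (mu i) - 1)"
      using ik mu f False unfolding e_spec_def by blast
    have "move_unit j k (move_unit k i mu) = ?nu" "move_unit k i mu j \<noteq> 0"
      using ijk False nz by (auto simp: move_unit_def fun_eq_iff)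
    then obtain h2 where h2: "acts (e_gen k j) (move_unit k i mu) h1 ?nu h2"
      "\<And>d. tdeg_le h1 d \<Longrightarrow> tdeg_le h2 (d + int (move_unit k i mu j) - int (move_unit k i mu k) - 1)"
      using kj h1(1) unfolding e_spec_def acts_def by metis
    have "tdeg_le h2 (d + int (mu j) - int (mu i) - 1)" if "tdeg_le f d" for d
    proof -
      have "(d + int (mu k) - int (mu i) - 1) + int (move_unit k i mu j) - int (move_unit k i mu k) - 1
          = d + int (mu j) - int (mu i) - 1"
        using ijk False by (simp add: move_unit_def of_nat_diff)
      then show ?thesis
        using h2(2)[OF h1(2)[OF that]] by (simp only:)
    qed
    then show ?thesis
      using acts_mult[OF h1(1) h2(1)] by blast
  qed
  then obtain g3 where g3: "acts (e_gen k j * e_gen i k) mu f ?nu g3"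
    "\<And>d. tdeg_le f d \<Longrightarrow> tdeg_le g3 (d + int (mu j) - int (mu i) - 1)"
    by blast
  show "\<exists>g. acts (e_gen i j) mu f ?nu g \<and>
      (\<forall>d. tdeg_le f d \<longrightarrow> tdeg_le g (d + int (mu j) - int (mu i) - 1))"
    using comm[OF acts_mult[OF g1(1) g2(1)] g3(1)] g2' g3(2) tdeg_le_diff by blast
qed

text \<open>Root vectors are built by commutators, one simple root at a time.\<close>

lemma e_spec_less: "i < j \<Longrightarrow> i \<in> {1..N} \<Longrightarrow> j \<in> {1..N} \<Longrightarrow> e_spec i j \<and> e_spec j i"
proof (induction j)
  case (Suc j)
  show ?case
  proof (cases "i = j")
    case True
    then show ?thesis
      using Suc.prems e_spec_E[of j] e_spec_F[of j] by auto
  next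
    case False
    then have "e_spec i j \<and> e_spec j i" "e_spec j (Suc j)" "e_spec (Suc j) j"
      using Suc e_spec_E[of j] e_spec_F[of j] by auto
    then show ?thesis
      using Suc.prems False e_spec_trans[of i j "Suc j"] e_spec_trans[of "Suc j" j i] by auto
  qed
qed simp

lemma e_spec: "i \<noteq> j \<Longrightarrow> i \<in> {1..N} \<Longrightarrow> j \<in> {1..N} \<Longrightarrow> e_spec i j"
  using e_spec_less[of i j] e_spec_less[of j i] by (cases "i < j") auto

lemma acts_ee:
  assumes mu: "mu \<in> comps N n" and f: "f \<in> sym_polys N n mu"
    and ij: "i \<noteq> j" "i \<in> {1..N}" "j \<in> {1..N}"
  shows "\<exists>g. acts (e_gen j i * e_gen i j) mu f mu g"
proof (cases "mu j = 0")
  case True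
  then have "acts (e_gen i j) mu f mu 0"
    using e_spec[OF ij] mu f by (auto simp: e_spec_def)
  then show ?thesis
    using acts_mult acts_zero_right[OF _ mu mu, of "e_gen j i"] Yadm_e_gen ij by blast
next
  case False
  let ?nu = "move_unit j i mu"
  obtain g where g: "acts (e_gen i j) mu f ?nu g"
    using e_spec[OF ij] mu f False unfolding e_spec_def by blast
  have "move_unit i j ?nu = mu" "?nu i \<noteq> 0"
    using ij False by (auto simp: move_unit_def fun_eq_iff)
  then obtain k where "acts (e_gen j i) ?nu g mu k"
    using e_spec[of j i] ij g unfolding e_spec_def acts_def by metis
  then show ?thesis
    using acts_mult[OF g] by blast
qed

text \<open>By degree reasons, since already \<open>e_{i,j} 1\<close> would have negative degree.\<close>

lemma acts_ee_one:
  assumes mu: "mu \<in> comps N n" and ij: "i \<noteq> j" "i \<in> {1..N}" "j \<in> {1..N}" and le: "mu j \<le> mu i"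
  shows "acts (e_gen j i * e_gen i j) mu 1 mu 0"
proof (cases "mu j = 0")
  case True
  then have "acts (e_gen i j) mu 1 mu 0"
    using e_spec[OF ij] mu coh.one_mem by (auto simp: e_spec_def)
  then show ?thesis
    using acts_mult acts_zero_right[OF _ mu mu, of "e_gen j i"] Yadm_e_gen ij by blast
next
  case False
  let ?nu = "move_unit j i mu"
  obtain g where g: "acts (e_gen i j) mu 1 ?nu g" "tdeg_le g (0 + int (mu j) - int (mu i) - 1)"
    using e_spec[OF ij] mu coh.one_mem[of N n mu] False tdeg_le_one unfolding e_spec_def by blast
  then have "g = 0"
    using le by (intro tdeg_le_neg[of g]) auto
  then have "acts (e_gen i j) mu 1 mu 0"
    using acts_zero_index[OF _ mu] g by blast
  then show ?thesis
    using acts_mult acts_zero_right[OF _ mu mu, of "e_gen j i"] Yadm_e_gen ij by blast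
qed

subsection \<open>Quantum multiplication\<close>

lemma acts_ee_swap:
  assumes "i \<in> {1..N}" "j \<in> {1..N}" "i \<noteq> j"
    and "mu \<in> comps N n" "f \<in> sym_polys N n mu"
    and "acts (e_gen j i * e_gen i j) mu f mu g"
  shows "acts (e_gen i j * e_gen j i) mu f mu (g + (of_nat (mu i) - of_nat (mu j)) * f)"
proof -
  have "acts (e_gen j i * e_gen i j + (e_gen i i - e_gen j j)) mu f mu
      (g + (of_nat (mu i) * f - of_nat (mu j) * f))"
    using assms by (intro acts_add acts_diff acts_e_gen_diag)
  moreover have "ycls N (e_gen j i * e_gen i j + (e_gen i i - e_gen j j)) = ycls N (e_gen i j * e_gen j i)"
  proof -
    have e: "e_gen a b \<in> free_carrier N" if "a \<in> {1..N}" "b \<in> {1..N}" for a b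
      using Yadm_e_gen[OF that] by (simp add: Yadm_def)
    have "e_gen i j * e_gen j i \<in> free_carrier N" "e_gen j i * e_gen i j \<in> free_carrier N"
      "e_gen i i - e_gen j j \<in> free_carrier N"
      using assms e by (auto intro!: free_carrier_mult free_carrier_diff)
    moreover from this have "(e_gen i j * e_gen j i - e_gen j i * e_gen i j) - (e_gen i i - e_gen j j) \<in> yang_ideal N"
      using e_gen_commutator[of i j j i N] assms
      by (simp add: yang.cls_eq_iff yang.diff_mem)
    then have "- ((e_gen i j * e_gen j i - e_gen j i * e_gen i j) - (e_gen i i - e_gen j j)) \<in> yang_ideal N"
      by (rule yang.uminus_mem_I)
    then have "(e_gen j i * e_gen i j + (e_gen i i - e_gen j j)) - e_gen i j * e_gen j i \<in> yang_ideal N"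
      by (simp add: algebra_simps)
    ultimately show ?thesis
      by (simp add: yang.cls_eq_iff yang.add_mem)
  qed
  moreover have "e_gen i j * e_gen j i \<in> Yadm N"
    using assms by (intro Yadm_mult Yadm_e_gen)
  ultimately show ?thesis
    using acts_cong_left by (simp add: left_diff_distrib)
qed

text \<open>The case distinction in \<open>G_lam\<close> always puts on the right the root vector
  moving a unit from the smaller group to the larger, or between equal ones.\<close>

lemma acts_G_lam_one:
  assumes "lam \<in> comps N n" "i \<in> {1..N}" "j \<in> {1..N}" "i \<noteq> j"
  shows "acts (G_lam lam i j) lam 1 lam 0"
  using assms acts_ee_one[of lam i j] acts_ee_one[of lam j i] by (auto simp: G_lam_def)

text \<open>Quantum multiplication orders the product by \<open>b\<close>, later
  \<open>j < i\<close>, while \<open>G_lam\<close> orders it by sizes; the orders differ by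
  \<open>0\<close> or plus or minus \<open>lam i - lam j\<close>. It is essential that
  \<open>s\<close> is chosen before \<open>f\<close>, whereas \<open>t\<close> is a mere choice of
  representatives.\<close>

lemma acts_G_lam:
  assumes lam: "lam \<in> comps N n" and ij: "i \<in> {1..N}" "j \<in> {1..N}" "i \<noteq> j"
  shows "\<exists>t s. \<forall>f\<in>sym_polys N n lam.
    acts (if b then e_gen j i * e_gen i j else e_gen i j * e_gen j i) lam f lam (t f) \<and>
    acts (G_lam lam i j) lam f lam (t f + pconst s * f)"
proof -
  define r where "r = (of_nat (lam i) - of_nat (lam j) :: complex)"
  have r: "pconst r = of_nat (lam i) - of_nat (lam j)"
    by (simp add: r_def pconst_diff pconst_of_nat)
  obtain t where t: "\<And>f. f \<in> sym_polys N n lam \<Longrightarrow> acts (e_gen j i * e_gen i j) lam f lam (t f)"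
    using acts_ee[OF lam _ ij(3,1,2)] by metis
  have t': "acts (e_gen i j * e_gen j i) lam f lam (t f + pconst r * f)" if "f \<in> sym_polys N n lam" for f
    unfolding r by (rule acts_ee_swap[OF ij lam that t[OF that]])
  show ?thesis
  proof (cases b)
    case True
    then show ?thesis
      using t t' by (intro exI[of _ t] exI[of _ "if lam i \<ge> lam j then 0 else r"]) (auto simp: G_lam_def)
  next
    case False
    then show ?thesis
      using t t'
      by (intro exI[of _ "\<lambda>f. t f + pconst r * f"] exI[of _ "if lam i \<ge> lam j then - r else 0"])
        (auto simp: G_lam_def pconst_uminus)
  qed
qed

lemma HX_incl_apply: "lam \<in> comps N n \<Longrightarrow> HX_incl N n lam x lam = x"
  by (simp add: HX_incl_def)

lemma quantum_mult_eq:
  assumes lam: "lam \<in> comps N n" and i: "i \<in> {1..N}"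
    and inj: "inj_on qt {1..N}" and nz: "\<forall>j\<in>{1..N}. qt j \<noteq> 0"
    and q: "\<forall>j\<in>{1..N}. q j = inverse (qt j)"
    and x: "x \<in> carrier (HT N n lam)"
  shows "HX_incl N n lam (quantum_mult N n rho qt lam i x) = rho (ycls N (X_q N q lam i)) (HX_incl N n lam x)"
proof -
  let ?S = "sym_polys N n lam" and ?H = "HT N n lam" and ?h = "pv Hv"
  let ?cls = "hcls N n lam"
  define Df where "Df = (\<Sum>j=1..lam i. pv (Gam i j))"
  have Df: "Df \<in> ?S"
    unfolding Df_def by (rule D_sym[OF i])
  define a where "a j = (qt j / qt i) / (1 - qt j / qt i)" for j
  define b where "b j = (qt i / qt j) / (1 - qt i / qt j)" for j
  have "\<exists>t s. \<forall>f\<in>?S. acts (if j < i then e_gen j i * e_gen i j else e_gen i j * e_gen j i) lam f lam (t f) \<and>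
      acts (G_lam lam i j) lam f lam (t f + pconst s * f)" if "j \<in> {1..N} - {i}" for j
    using that i by (intro acts_G_lam lam) auto
  then obtain t s where ts: "\<And>j f. j \<in> {1..N} - {i} \<Longrightarrow> f \<in> ?S \<Longrightarrow>
      acts (if j < i then e_gen j i * e_gen i j else e_gen i j * e_gen j i) lam f lam (t j f) \<and>
      acts (G_lam lam i j) lam f lam (t j f + pconst (s j) * f)"
    by metis
  have t_lt: "acts (e_gen j i * e_gen i j) lam f lam (t j f)" if "j \<in> {1..<i}" "f \<in> ?S" for j f
    using ts[of j f] that i by auto
  have t_gt: "acts (e_gen i j * e_gen j i) lam f lam (t j f)" if "j \<in> {Suc i..N}" "f \<in> ?S" for j f
    using ts[of j f] that i by auto
  have t_sym: "t j f \<in> ?S" if "j \<in> {1..<i} \<union> {Suc i..N}" "f \<in> ?S" for j f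
    using t_lt[of j f] t_gt[of j f] that by (auto simp: acts_def)
  \<comment> \<open>For \<open>j < i\<close> inversion of the parameters produces a minus sign that
    cancels the one in \<open>X_q\<close>; for \<open>j > i\<close>, in \<open>ratio'\<close>, it
    produces none.\<close>
  have ratio: "1 / u / (1 / u - 1 / v) = - (v / u / (1 - v / u))" if "v \<noteq> 0" "u \<noteq> 0" "v \<noteq> u" for u v :: complex
  proof -
    have "1 / u - 1 / v = (v - u) / (u * v)" "1 - v / u = (u - v) / u"
      using that by (simp_all add: field_simps)
    then show ?thesis
      using that by (simp add: divide_simps) (simp add: algebra_simps)
  qed
  have ratio': "1 / v / (1 / u - 1 / v) = u / v / (1 - u / v)" if "v \<noteq> 0" "u \<noteq> 0" "v \<noteq> u" for u v :: complex
  proof -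
    have "1 / u - 1 / v = (v - u) / (u * v)" "1 - u / v = (v - u) / v"
      using that by (simp_all add: field_simps)
    then show ?thesis
      using that by simp
  qed
  have qa: "q i / (q i - q j) = - a j" if "j \<in> {1..<i}" for j
  proof -
    have ne: "qt j \<noteq> 0" "qt i \<noteq> 0" "qt j \<noteq> qt i"
      using that i nz inj by (auto dest: inj_onD)
    have "q i = 1 / qt i" "q j = 1 / qt j"
      using that i q by (simp_all add: inverse_eq_divide)
    then show ?thesis
      using ratio[OF ne] by (simp only: a_def)
  qed
  have qb: "q j / (q i - q j) = b j" if "j \<in> {Suc i..N}" for j
  proof -
    have ne: "qt j \<noteq> 0" "qt i \<noteq> 0" "qt j \<noteq> qt i"
      using that i nz inj by (auto dest: inj_onD)
    have "q i = 1 / qt i" "q j = 1 / qt j"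
      using that i q by (simp_all add: inverse_eq_divide)
    then show ?thesis
      using ratio'[OF ne] by (simp only: b_def)
  qed
  have X: "X_q N q lam i = X_inf i - hY * (\<Sum>j=1..<i. yconst [:- a j:] * G_lam lam i j)
      - hY * (\<Sum>j=Suc i..N. yconst [:b j:] * G_lam lam i j)"
  proof -
    have "(\<Sum>j=1..<i. yconst [:q i / (q i - q j):] * G_lam lam i j) = (\<Sum>j=1..<i. yconst [:- a j:] * G_lam lam i j)"
      by (rule sum.cong) (simp_all only: qa)
    moreover have "(\<Sum>j=Suc i..N. yconst [:q j / (q i - q j):] * G_lam lam i j) = (\<Sum>j=Suc i..N. yconst [:b j:] * G_lam lam i j)"
      by (rule sum.cong) (simp_all only: qb)
    ultimately show ?thesis
      unfolding X_q_def by (simp only:)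
  qed
  define g where "g f = Df * f - ?h * (\<Sum>j=1..<i. pconst (- a j) * (t j f + pconst (s j) * f))
      - ?h * (\<Sum>j=Suc i..N. pconst (b j) * (t j f + pconst (s j) * f))" for f
  have act: "acts (X_q N q lam i) lam f lam (g f)" if f: "f \<in> ?S" for f
    unfolding X g_def Df_def
    using ts[OF _ f] i
    by (intro acts_diff acts_hY_mult acts_sum acts_scalar_mult acts_X_inf lam f) auto
  \<comment> \<open>A second evaluation at \<open>1\<close>, now with \<open>0\<close> representing
    each \<open>G_lam\<close> term. It agrees with \<open>g 1\<close> only modulo the ideal.\<close>
  have "acts (X_q N q lam i) lam 1 lam (Df * 1 - ?h * (\<Sum>j=1..<i. pconst (- a j) * 0)
      - ?h * (\<Sum>j=Suc i..N. pconst (b j) * 0))"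
    unfolding X Df_def using i
    by (intro acts_diff acts_hY_mult acts_sum acts_scalar_mult acts_X_inf acts_G_lam_one lam coh.one_mem) auto
  then have act1: "acts (X_q N q lam i) lam 1 lam Df"
    by simp
  \<comment> \<open>The candidate for the scalar \<open>C\<close>, collecting all the order
    corrections \<open>s j\<close>.\<close>
  define c where "c = - ?h * (\<Sum>j=1..<i. pconst (- a j) * pconst (s j)) - ?h * (\<Sum>j=Suc i..N. pconst (b j) * pconst (s j))"
  have c_base: "c \<in> polys_in (base_vars n)"
    unfolding c_def by (intro polys_in_diff polys_in_mult polys_in_uminus polys_in_sum Hv_base polys_in_pconst)
  have sym: "p \<in> ?S" if "p \<in> polys_in (base_vars n)" for p
    by (rule base_in_sym_polys[OF that])
  \<comment> \<open>Representative of ordinary multiplication plus the quantum sums, without the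
    scalar.\<close>
  define B where "B f = Df * f + (\<Sum>j=1..<i. pconst (a j) * ?h * t j f)
      - (\<Sum>j=Suc i..N. pconst (b j) * ?h * t j f)" for f
  have B: "B f \<in> ?S" if "f \<in> ?S" for f
    unfolding B_def using t_sym that Df
    by (intro coh.diff_mem coh.add_mem coh.mult_mem coh.sum_mem pconst_sym Hv_sym) auto
  have split: "?h * (\<Sum>j\<in>A. pconst (k j) * (t j f + pconst (s j) * f)) =
      (\<Sum>j\<in>A. pconst (k j) * ?h * t j f) + ?h * (\<Sum>j\<in>A. pconst (k j) * pconst (s j)) * f" for A k f
    by (simp add: distrib_left sum.distrib sum_distrib_left sum_distrib_right mult_ac)
  have gB: "g f = B f + c * f" for f
    unfolding g_def B_def c_def split by (simp add: pconst_uminus sum_negf left_diff_distrib)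
  let ?Bop = "\<lambda>x. D_cls N n lam i \<otimes>\<^bsub>?H\<^esub> x
      \<oplus>\<^bsub>?H\<^esub> (\<Oplus>\<^bsub>?H\<^esub>j\<in>{1..<i}. ?cls (pconst (a j) * ?h) \<otimes>\<^bsub>?H\<^esub> ee_op N n rho lam j i x)
      \<ominus>\<^bsub>?H\<^esub> (\<Oplus>\<^bsub>?H\<^esub>j\<in>{Suc i..N}. ?cls (pconst (b j) * ?h) \<otimes>\<^bsub>?H\<^esub> ee_op N n rho lam i j x)"
  have D: "D_cls N n lam i = ?cls Df"
    by (simp add: D_cls_def Df_def)
  have Bop: "?Bop (?cls f) = ?cls (B f)" if f: "f \<in> ?S" for f
  proof -
    interpret H: ring ?H
      by (rule coh.ring_Q)
    have "(\<Oplus>\<^bsub>?H\<^esub>j\<in>{1..<i}. ?cls (pconst (a j) * ?h) \<otimes>\<^bsub>?H\<^esub> ee_op N n rho lam j i (?cls f))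
        = (\<Oplus>\<^bsub>?H\<^esub>j\<in>{1..<i}. ?cls (pconst (a j) * ?h * t j f))"
    proof (rule H.finsum_cong')
      fix j assume j: "j \<in> {1..<i}"
      have "ee_op N n rho lam j i (?cls f) = ?cls (t j f)"
        using t_lt[OF j f] lam by (simp add: ee_op_def acts_def HX_incl_apply)
      then show "?cls (pconst (a j) * ?h) \<otimes>\<^bsub>?H\<^esub> ee_op N n rho lam j i (?cls f) = ?cls (pconst (a j) * ?h * t j f)"
        using t_sym[of j f] j f by (simp add: coh.cls_mult coh.mult_mem)
    qed (use t_sym f in \<open>auto intro!: coh.cls_closed coh.mult_mem\<close>)
    moreover have "(\<Oplus>\<^bsub>?H\<^esub>j\<in>{Suc i..N}. ?cls (pconst (b j) * ?h) \<otimes>\<^bsub>?H\<^esub> ee_op N n rho lam i j (?cls f))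
        = (\<Oplus>\<^bsub>?H\<^esub>j\<in>{Suc i..N}. ?cls (pconst (b j) * ?h * t j f))"
    proof (rule H.finsum_cong')
      fix j assume j: "j \<in> {Suc i..N}"
      have "ee_op N n rho lam i j (?cls f) = ?cls (t j f)"
        using t_gt[OF j f] lam by (simp add: ee_op_def acts_def HX_incl_apply)
      then show "?cls (pconst (b j) * ?h) \<otimes>\<^bsub>?H\<^esub> ee_op N n rho lam i j (?cls f) = ?cls (pconst (b j) * ?h * t j f)"
        using t_sym[of j f] j f by (simp add: coh.cls_mult coh.mult_mem)
    qed (use t_sym f in \<open>auto intro!: coh.cls_closed coh.mult_mem\<close>)
    moreover have "(\<Oplus>\<^bsub>?H\<^esub>j\<in>{1..<i}. ?cls (pconst (a j) * ?h * t j f)) = ?cls (\<Sum>j\<in>{1..<i}. pconst (a j) * ?h * t j f)"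
      using t_sym f by (intro coh.cls_sum) (auto intro!: coh.mult_mem)
    moreover have "(\<Oplus>\<^bsub>?H\<^esub>j\<in>{Suc i..N}. ?cls (pconst (b j) * ?h * t j f)) = ?cls (\<Sum>j\<in>{Suc i..N}. pconst (b j) * ?h * t j f)"
      using t_sym f by (intro coh.cls_sum) (auto intro!: coh.mult_mem)
    moreover have "(\<Sum>j\<in>{1..<i}. pconst (a j) * ?h * t j f) \<in> ?S" "(\<Sum>j\<in>{Suc i..N}. pconst (b j) * ?h * t j f) \<in> ?S"
      using t_sym f by (auto intro!: coh.sum_mem coh.mult_mem)
    ultimately show ?thesis
      using f Df by (simp add: D B_def coh.cls_mult coh.cls_add coh.cls_diff coh.mult_mem coh.add_mem)
  qed
  define P where "P Q \<longleftrightarrow> Q \<in> extensional (carrier ?H) \<and>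
      (\<exists>c\<in>polys_in (base_vars n). \<forall>x\<in>carrier ?H. Q x = ?Bop x \<oplus>\<^bsub>?H\<^esub> ?cls c \<otimes>\<^bsub>?H\<^esub> x) \<and>
      Q \<one>\<^bsub>?H\<^esub> \<ominus>\<^bsub>?H\<^esub> D_cls N n lam i \<otimes>\<^bsub>?H\<^esub> \<one>\<^bsub>?H\<^esub> = \<zero>\<^bsub>?H\<^esub>" for Q
  have qm: "quantum_mult N n rho qt lam i = (THE Q. P Q)"
    unfolding quantum_mult_def Let_def P_def a_def b_def by (rule refl)
  \<comment> \<open>Restricted to the carrier because the definite description asks for an
    extensional function.\<close>
  define Q where "Q = (\<lambda>x\<in>carrier ?H. rho (ycls N (X_q N q lam i)) (HX_incl N n lam x) lam)"
  have Q_cls: "Q (?cls f) = ?cls (g f)" if "f \<in> ?S" for f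
    using act[OF that] lam that by (simp add: Q_def acts_def HX_incl_apply coh.cls_closed)
  have g_sym: "g f \<in> ?S" if "f \<in> ?S" for f
    using act[OF that] by (simp add: acts_def)
  have Q1: "?cls (g 1) = ?cls Df"
    using act[OF coh.one_mem] act1 lam unfolding acts_def by (metis HX_incl_apply)
  have form: "?Bop (?cls f) \<oplus>\<^bsub>?H\<^esub> ?cls p \<otimes>\<^bsub>?H\<^esub> ?cls f = ?cls (B f + p * f)"
    if "f \<in> ?S" "p \<in> polys_in (base_vars n)" for f p
    unfolding Bop[OF that(1)] using that sym[OF that(2)] B[OF that(1)]
    by (simp add: coh.cls_mult coh.cls_add coh.mult_mem)
  have norm: "v \<ominus>\<^bsub>?H\<^esub> D_cls N n lam i \<otimes>\<^bsub>?H\<^esub> \<one>\<^bsub>?H\<^esub> = \<zero>\<^bsub>?H\<^esub> \<longleftrightarrow> v = ?cls Df"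
    if v: "v \<in> carrier ?H" for v
  proof -
    obtain k where "k \<in> ?S" "v = ?cls k"
      using v unfolding coh.carrier_Q by (rule imageE) (rule that)
    then show ?thesis
      using Df by (simp add: D coh.cls_one coh.cls_zero coh.cls_mult coh.one_mem coh.cls_diff
          coh.cls_eq_iff coh.diff_mem coh.zero_mem)
  qed
  have PQ: "P Q"
    unfolding P_def
  proof (intro conjI bexI[OF _ c_base] ballI)
    show "Q \<in> extensional (carrier ?H)"
      by (simp add: Q_def)
    fix x assume "x \<in> carrier ?H"
    then obtain f where f: "f \<in> ?S" "x = ?cls f"
      unfolding coh.carrier_Q by (rule imageE) (rule that)
    show "Q x = ?Bop x \<oplus>\<^bsub>?H\<^esub> ?cls c \<otimes>\<^bsub>?H\<^esub> x"
      unfolding f(2) form[OF f(1) c_base] Q_cls[OF f(1)] gB by (rule refl)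
  next
    have "Q \<one>\<^bsub>?H\<^esub> = ?cls Df"
      unfolding coh.cls_one using Q_cls[OF coh.one_mem] Q1 by simp
    then show "Q \<one>\<^bsub>?H\<^esub> \<ominus>\<^bsub>?H\<^esub> D_cls N n lam i \<otimes>\<^bsub>?H\<^esub> \<one>\<^bsub>?H\<^esub> = \<zero>\<^bsub>?H\<^esub>"
      using norm coh.cls_closed[OF Df] by simp
  qed
  have unique: "Q' = Q" if "P Q'" for Q'
  proof -
    obtain c' where c': "c' \<in> polys_in (base_vars n)"
      and Q': "\<And>x. x \<in> carrier ?H \<Longrightarrow> Q' x = ?Bop x \<oplus>\<^bsub>?H\<^esub> ?cls c' \<otimes>\<^bsub>?H\<^esub> x"
      using \<open>P Q'\<close> unfolding P_def by blast
    have Q'_cls: "Q' (?cls f) = ?cls (B f + c' * f)" if "f \<in> ?S" for f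
      using Q'[OF coh.cls_closed[OF that]] unfolding form[OF that c'] .
    have c'_sym: "c' \<in> ?S" and c_sym: "c \<in> ?S"
      using sym c' c_base by auto
    have "Q' \<one>\<^bsub>?H\<^esub> = ?cls Df"
    proof -
      have "Q' \<one>\<^bsub>?H\<^esub> \<in> carrier ?H"
        unfolding coh.cls_one Q'_cls[OF coh.one_mem]
        by (intro coh.cls_closed coh.add_mem coh.mult_mem B coh.one_mem c'_sym)
      then show ?thesis
        using norm \<open>P Q'\<close> unfolding P_def by blast
    qed
    then have "?cls (B 1 + c') = ?cls (B 1 + c)"
      using Q'_cls[OF coh.one_mem] Q1 gB[of 1] by (simp add: coh.cls_one)
    \<comment> \<open>Normalization identifies the constants only modulo the ideal; absorption then
      makes the two operators agree on every class.\<close>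
    then have "c' - c \<in> coh_ideal N n lam"
      using B[OF coh.one_mem] c'_sym c_sym by (simp add: coh.cls_eq_iff coh.add_mem)
    then have "(c' - c) * f \<in> coh_ideal N n lam" if "f \<in> ?S" for f
      using coh.mult_right_mem_I that by blast
    then have "?cls (B f + c' * f) = ?cls (B f + c * f)" if "f \<in> ?S" for f
      using that B[OF that] c'_sym c_sym
      by (simp add: coh.cls_eq_iff coh.add_mem coh.mult_mem left_diff_distrib)
    then have eq: "Q' (?cls f) = Q (?cls f)" if "f \<in> ?S" for f
      using that Q'_cls Q_cls gB by simp
    show ?thesis
    proof (rule extensionalityI)
      show "Q' \<in> extensional (carrier ?H)" "Q \<in> extensional (carrier ?H)"
        using \<open>P Q'\<close> PQ by (auto simp: P_def)
    qed (use eq in \<open>auto simp: coh.carrier_Q\<close>)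
  qed
  have "quantum_mult N n rho qt lam i = Q"
    unfolding qm by (rule the_equality[of P, OF PQ unique])
  moreover obtain f where f: "f \<in> ?S" "x = ?cls f"
    using x unfolding coh.carrier_Q by (rule imageE) (rule that)
  ultimately show ?thesis
    using Q_cls[OF f(1)] act[OF f(1)] by (simp add: f(2) acts_def)
qed

end

theorem corollary7p6:
  fixes N n :: nat
    and lam :: "nat \<Rightarrow> nat"
    and qt q :: "nat \<Rightarrow> complex"
    and rho :: "free_alg set \<Rightarrow> coh_family \<Rightarrow> coh_family"
    and i :: nat
  assumes "N \<ge> 1" and "n \<ge> 1"
    and "lam \<in> comps N n"
    and "inj_on qt {1..N}"
    and "\<forall>j\<in>{1..N}. qt j \<noteq> 0"
    and "\<forall>j\<in>{1..N}. q j = inverse (qt j)"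
    and "yangian_action N n rho"
    and "i \<in> {1..N}"
  shows "\<forall>x\<in>carrier (HT N n lam).
           HX_incl N n lam (quantum_mult N n rho qt lam i x)
           = rho (ycls N (X_q N q lam i)) (HX_incl N n lam x)"
  using yangian_action.quantum_mult_eq[OF assms(7,3,8,4,5,6)] by blast

end
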